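(* Let $\mathfrak g$ be the simple Lie algebra of type $C_2$ and $U_0$ the centralizer of its Cartan subalgebra in $U(\mathfrak g)$. With the notation of the context: 1) The following set of monomials is a basis of $U_0$: $$P=\{h_1^{s_1}h_2^{s_2}c_1^{s_3}c_2^{s_4}c_3^{s_5}c_4^{s_6}c_m^{s_m}c_n^{s_n}\ :\ s_1,\dots,s_6,s_m,s_n\in\mathbb N,\ (m,n)\in E\},$$ where $\mathbb N$ is the set of nonnegative integers, the exponents $s_m,s_n$ of the last two factors are independent of $s_1,\dots,s_6$, and $$E=\{(5,9),(5,12),(6,10),(6,11),(7,9),(7,11),(8,10),(8,12)\}.$$ 2) The set $\tilde K=\{X\in K':\mathrm{Len}(X)=2\}$ is a generating set of the ideal of relations $K$.
   Context: Realize $\mathfrak g$ of type $C_2$ by $4\times4$ matrices ($E_{ij}$ are matrix units) with basis $e_{10}=E_{12}-E_{43}$, $f_{10}=E_{21}-E_{34}$, $e_{01}=E_{31}$, $f_{01}=E_{13}$, $h_{10}=E_{11}-E_{22}-E_{33}+E_{44}$, $h_{01}=-E_{11}+E_{33}$, $e_{11}=-E_{32}-E_{41}$, $e_{21}=2E_{42}$, $f_{11}=-E_{14}-E_{23}$, $f_{21}=2E_{24}$. The Cartan subalgebra is $\mathfrak h=\mathrm{span}(h_{10},h_{01})$. Set $h_1=h_{01}$, $h_2=h_{10}$ and consider the following elements of $U_0$: $c_1=f_{01}e_{01}$, $c_2=f_{21}e_{21}$, $c_3=f_{10}e_{10}$, $c_4=f_{11}e_{11}$, $c_5=f_{11}e_{01}e_{10}$,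 $c_6=f_{10}f_{01}e_{11}$, $c_7=f_{21}e_{11}e_{10}$, $c_8=f_{10}f_{11}e_{21}$, $c_9=f_{21}e_{01}e_{10}e_{10}$, $c_{10}=f_{10}f_{10}f_{01}e_{21}$, $c_{11}=f_{01}f_{21}e_{11}e_{11}$, $c_{12}=f_{11}f_{11}e_{21}e_{01}$. The elements $h_1,h_2,c_1,\dots,c_{12}$ generate $U_0$. Consider words in the letters $h_1,h_2,c_1,\dots,c_{12}$, with $h_1<h_2<c_1<c_2<\dots<c_{12}$. For such a word $Y$ let $\omega(Y)$ be the word in the basis elements of $\mathfrak g$ obtained by replacing each $c_i$ by the product defining it. Two words $Y,Y'$ are equivalent if $\omega(Y)$ and $\omega(Y')$ differ only by a permutation of letters. A word is semi-perfect if it is lexicographically minimal in its equivalence class. The values of semi-perfect words form a basis of $U_0$. Let $F=\mathbb C[h_1,h_2]\langle c_1,\dots,c_{12}\rangle$ be the free associative algebra over the polynomial ring $\mathbb C[h_1,h_2]$ (with the $c_i$ now regarded as symbols), and let $K$ (the ideal of relations) be the kernel of the natural surjection $F\to U_0$. For $X\in F$, $\mathcal N(X)$ denotes the unique linear combination of semi-perfect words with the same image in $U_0$ as $X$. Let $K'=\{c_{i_1}\cdots c_{i_m}-\mathcal N(c_{i_1}\cdots c_{i_m}): m\le 4,\ 1\le i_1,\dots,i_m\le12\}$ and $\mathrm{Len}\big(c_{i_1}\cdots c_{i_m}-\mathcal N(c_{i_1}\cdots c_{i_m})\big)=m$. Generation is as a two-sided ideal of $F$. *)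

theory Defs
  imports "HOL-Analysis.Analysis" "HOL-Library.Poly_Mapping" "HOL-Library.Multiset"
begin

section \<open>Free associative algebras and two-sided ideals\<close>

text \<open>
  Lists form the free monoid under concatenation, so that \<open>'a list \<Rightarrow>\<^sub>0 'k\<close>, with the
  convolution product of \<^theory>\<open>HOL-Library.Poly_Mapping\<close>, is the free associative unital
  algebra over the coefficient ring \<open>'k\<close> on the letters \<open>'a\<close>.  The coefficients are central.
\<close>

instantiation list :: (type) monoid_add
begin

definition zero_list :: "'a list" where "zero_list = []"

definition plus_list :: "'a list \<Rightarrow> 'a list \<Rightarrow> 'a list" where "plus_list = (@)"

instance by standard (simp_all add: zero_list_def plus_list_def)

end

definition two_sided_ideal :: "'a::ring_1 set \<Rightarrow> bool" where
  "two_sided_ideal I \<longleftrightarrow> 0 \<in> I \<and> (\<forall>x\<in>I. \<forall>y\<in>I. x + y \<in> I) \<and>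
     (\<forall>a. \<forall>x\<in>I. a * x \<in> I \<and> x * a \<in> I)"

abbreviation ideal_generated_by :: "'a::ring_1 set \<Rightarrow> 'a set" where
  "ideal_generated_by S \<equiv> two_sided_ideal hull S"

lemma two_sided_ideal_hull: "two_sided_ideal (ideal_generated_by S)"
  by (rule hull_in) (auto simp: two_sided_ideal_def)

lemma two_sided_ideal_uminus: "two_sided_ideal I \<Longrightarrow> x \<in> I \<Longrightarrow> - x \<in> I"
  by (metis mult_minus1 two_sided_ideal_def)


section \<open>The universal enveloping algebra of a complex Lie algebra\<close>

class complex_lie_algebra = ab_group_add +
  fixes lie_scale :: "complex \<Rightarrow> 'a \<Rightarrow> 'a"
    and lie_bracket :: "'a \<Rightarrow> 'a \<Rightarrow> 'a"
  assumes lie_scale_add_right: "lie_scale a (x + y) = lie_scale a x + lie_scale a y"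
    and lie_scale_add_left: "lie_scale (a + b) x = lie_scale a x + lie_scale b x"
    and lie_scale_scale: "lie_scale a (lie_scale b x) = lie_scale (a * b) x"
    and lie_scale_one: "lie_scale 1 x = x"
    and lie_bracket_add_left: "lie_bracket (x + y) z = lie_bracket x z + lie_bracket y z"
    and lie_bracket_add_right: "lie_bracket x (y + z) = lie_bracket x y + lie_bracket x z"
    and lie_bracket_scale_left: "lie_bracket (lie_scale a x) y = lie_scale a (lie_bracket x y)"
    and lie_bracket_scale_right: "lie_bracket x (lie_scale a y) = lie_scale a (lie_bracket x y)"
    and lie_bracket_self: "lie_bracket x x = 0"
    and lie_jacobi: "lie_bracket x (lie_bracket y z) + lie_bracket y (lie_bracket z x)
                       + lie_bracket z (lie_bracket x y) = 0"

interpretation lie: vector_space "lie_scale :: complex \<Rightarrow> 'a::complex_lie_algebra \<Rightarrow> 'a"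
  by standard
    (simp_all add: lie_scale_add_right lie_scale_add_left lie_scale_scale lie_scale_one)

definition free_const :: "complex \<Rightarrow> ('a list \<Rightarrow>\<^sub>0 complex)" where
  "free_const c = Poly_Mapping.single [] c"

definition free_letter :: "'a \<Rightarrow> ('a list \<Rightarrow>\<^sub>0 complex)" where
  "free_letter x = Poly_Mapping.single [x] 1"

text \<open>
  All elements of the Lie algebra are letters; the first two families of relations cut the free
  algebra on them down to the tensor algebra.
\<close>

definition uea_relations :: "('a::complex_lie_algebra list \<Rightarrow>\<^sub>0 complex) set" where
  "uea_relations =
     {free_letter (x + y) - free_letter x - free_letter y | x y. True} \<union>
     {free_letter (lie_scale c x) - free_const c * free_letter x | c x. True} \<union>
     {free_letter x * free_letter y - free_letter y * free_letter x
        - free_letter (lie_bracket x y) | x y. True}"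

definition uea_ideal :: "('a::complex_lie_algebra list \<Rightarrow>\<^sub>0 complex) set" where
  "uea_ideal = ideal_generated_by uea_relations"

lemma two_sided_ideal_uea_ideal: "two_sided_ideal uea_ideal"
  unfolding uea_ideal_def by (rule two_sided_ideal_hull)

lemmas uea_ideal_zero = two_sided_ideal_uea_ideal[unfolded two_sided_ideal_def, THEN conjunct1]

lemma uea_ideal_add: "x \<in> uea_ideal \<Longrightarrow> y \<in> uea_ideal \<Longrightarrow> x + y \<in> uea_ideal"
  and uea_ideal_mult_left: "x \<in> uea_ideal \<Longrightarrow> a * x \<in> uea_ideal"
  and uea_ideal_mult_right: "x \<in> uea_ideal \<Longrightarrow> x * a \<in> uea_ideal"
  using two_sided_ideal_uea_ideal unfolding two_sided_ideal_def by blast+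

lemma uea_ideal_uminus: "x \<in> uea_ideal \<Longrightarrow> - x \<in> uea_ideal"
  by (rule two_sided_ideal_uminus[OF two_sided_ideal_uea_ideal])

lemma lookup_times_Nil:
  fixes p q :: "'a list \<Rightarrow>\<^sub>0 complex"
  shows "Poly_Mapping.lookup (p * q) [] = Poly_Mapping.lookup p [] * Poly_Mapping.lookup q []"
proof -
  have *: "(\<Sum>r. Poly_Mapping.lookup q r when [] = l + r) = (Poly_Mapping.lookup q [] when l = [])" for l :: "'a list"
  proof (cases "l = []")
    case True
    then have "(\<Sum>r. Poly_Mapping.lookup q r when [] = l + r) = (\<Sum>r. Poly_Mapping.lookup q r when [] = r)"
      by (simp add: plus_list_def)
    then show ?thesis using True by simp
  qed (simp add: plus_list_def)
  have "Poly_Mapping.lookup (p * q) [] = (\<Sum>l. Poly_Mapping.lookup p l * (Poly_Mapping.lookup q [] when l = []))"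
    by (simp add: times_poly_mapping.rep_eq prod_fun_def *)
  also have "\<dots> = (\<Sum>l. Poly_Mapping.lookup p l * Poly_Mapping.lookup q [] when l = [])"
    by (simp add: mult_when)
  finally show ?thesis by simp
qed

lemma uea_ideal_lookup_Nil: "x \<in> uea_ideal \<Longrightarrow> Poly_Mapping.lookup x [] = 0"
proof -
  let ?I = "{x :: 'a list \<Rightarrow>\<^sub>0 complex. Poly_Mapping.lookup x [] = 0}"
  have "two_sided_ideal ?I"
    by (auto simp: two_sided_ideal_def lookup_add lookup_times_Nil)
  moreover have "(uea_relations :: ('a list \<Rightarrow>\<^sub>0 complex) set) \<subseteq> ?I"
    by (auto simp: uea_relations_def free_letter_def lookup_minus lookup_times_Nil lookup_single)
  ultimately have "uea_ideal \<subseteq> ?I"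
    unfolding uea_ideal_def by (simp add: hull_minimal)
  then show "x \<in> uea_ideal \<Longrightarrow> Poly_Mapping.lookup x [] = 0" by auto
qed

definition uea_rel :: "('a::complex_lie_algebra list \<Rightarrow>\<^sub>0 complex) \<Rightarrow> ('a list \<Rightarrow>\<^sub>0 complex) \<Rightarrow> bool"
  where "uea_rel x y \<longleftrightarrow> x - y \<in> uea_ideal"

quotient_type (overloaded) 'a uea = "'a::complex_lie_algebra list \<Rightarrow>\<^sub>0 complex" / uea_rel
proof (rule equivpI)
  show "reflp (uea_rel :: ('a list \<Rightarrow>\<^sub>0 complex) \<Rightarrow> _)"
    by (rule reflpI) (simp add: uea_rel_def uea_ideal_zero)
  show "symp (uea_rel :: ('a list \<Rightarrow>\<^sub>0 complex) \<Rightarrow> _)"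
    by (rule sympI) (use uea_ideal_uminus minus_diff_eq uea_rel_def in metis)
  show "transp (uea_rel :: ('a list \<Rightarrow>\<^sub>0 complex) \<Rightarrow> _)"
  proof (rule transpI)
    fix x y z :: "'a list \<Rightarrow>\<^sub>0 complex"
    assume "uea_rel x y" "uea_rel y z"
    then have "(x - y) + (y - z) \<in> uea_ideal"
      unfolding uea_rel_def by (rule uea_ideal_add)
    then show "uea_rel x z" by (simp add: uea_rel_def)
  qed
qed

instantiation uea :: (complex_lie_algebra) ring_1
begin

lift_definition zero_uea :: "'a uea" is 0 .

lift_definition one_uea :: "'a uea" is 1 .

lift_definition plus_uea :: "'a uea \<Rightarrow> 'a uea \<Rightarrow> 'a uea" is "(+)"
  unfolding uea_rel_def by (metis uea_ideal_add add_diff_add)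

lift_definition uminus_uea :: "'a uea \<Rightarrow> 'a uea" is uminus
  unfolding uea_rel_def by (metis uea_ideal_uminus minus_diff_minus)

lift_definition minus_uea :: "'a uea \<Rightarrow> 'a uea \<Rightarrow> 'a uea" is "(-)"
proof -
  fix a b c d :: "'a list \<Rightarrow>\<^sub>0 complex"
  assume "uea_rel a b" "uea_rel c d"
  then have "(a - b) + - (c - d) \<in> uea_ideal"
    unfolding uea_rel_def by (intro uea_ideal_add uea_ideal_uminus)
  then show "uea_rel (a - c) (b - d)" by (simp add: uea_rel_def algebra_simps)
qed

lift_definition times_uea :: "'a uea \<Rightarrow> 'a uea \<Rightarrow> 'a uea" is "(*)"
proof -
  fix a b c d :: "'a list \<Rightarrow>\<^sub>0 complex"
  assume "uea_rel a b" "uea_rel c d"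
  then have "(a - b) * c + b * (c - d) \<in> uea_ideal"
    unfolding uea_rel_def by (intro uea_ideal_add uea_ideal_mult_left uea_ideal_mult_right)
  then show "uea_rel (a * c) (b * d)" by (simp add: uea_rel_def algebra_simps)
qed

instance
proof
  show "(0 :: 'a uea) \<noteq> 1"
  proof (transfer, unfold uea_rel_def, rule notI)
    assume "(0 :: 'a list \<Rightarrow>\<^sub>0 complex) - 1 \<in> uea_ideal"
    from uea_ideal_lookup_Nil[OF this] show False
      by (simp add: lookup_minus lookup_one zero_list_def)
  qed
qed (transfer, simp add: uea_rel_def algebra_simps uea_ideal_zero)+

end

lift_definition uea_scale :: "complex \<Rightarrow> 'a::complex_lie_algebra uea \<Rightarrow> 'a uea"
  is "\<lambda>c x. free_const c * x"
  unfolding uea_rel_def by (metis uea_ideal_mult_left right_diff_distrib)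

interpretation uea: vector_space "uea_scale :: complex \<Rightarrow> 'a::complex_lie_algebra uea \<Rightarrow> 'a uea"
proof
  fix a b :: complex and x y :: "'a uea"
  have mult: "free_const a * free_const b = (free_const (a * b) :: 'a list \<Rightarrow>\<^sub>0 complex)"
    by (simp add: free_const_def mult_single plus_list_def)
  have one: "free_const 1 = (1 :: 'a list \<Rightarrow>\<^sub>0 complex)"
    by (simp add: free_const_def single_one flip: zero_list_def)
  have add: "free_const (a + b) = (free_const a + free_const b :: 'a list \<Rightarrow>\<^sub>0 complex)"
    by (simp add: free_const_def single_add)
  show "uea_scale a (x + y) = uea_scale a x + uea_scale a y"
    by transfer (simp add: uea_rel_def algebra_simps uea_ideal_zero)
  show "uea_scale (a + b) x = uea_scale a x + uea_scale b x"
    using add by transfer (simp add: uea_rel_def algebra_simps uea_ideal_zero)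
  show "uea_scale a (uea_scale b x) = uea_scale (a * b) x"
    using mult by transfer (simp add: uea_rel_def uea_ideal_zero flip: mult.assoc)
  show "uea_scale 1 x = x"
    using one by transfer (simp add: uea_rel_def uea_ideal_zero)
qed

lift_definition uea_incl :: "'a::complex_lie_algebra \<Rightarrow> 'a uea" is free_letter .


section \<open>The Lie algebra of type $C_2$\<close>

definition cmat_scale :: "complex \<Rightarrow> complex^'n^'m \<Rightarrow> complex^'n^'m" where
  "cmat_scale c A = (\<chi> i j. c * A $ i $ j)"

interpretation cmat: vector_space "cmat_scale :: complex \<Rightarrow> complex^'n^'m \<Rightarrow> complex^'n^'m"
  by standard (simp_all add: cmat_scale_def vec_eq_iff algebra_simps)

definition commutator :: "complex^'n^'n \<Rightarrow> complex^'n^'n \<Rightarrow> complex^'n^'n" where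
  "commutator A B = A ** B - B ** A"

lemma matrix_diff_ldistrib: "A ** (B - C) = A ** B - A ** C"
  and matrix_diff_rdistrib: "(B - C) ** A = B ** A - C ** A" for A B C :: "complex^'n^'n"
  by (simp_all add: matrix_matrix_mult_def vec_eq_iff sum_subtractf algebra_simps)

text \<open>In the index type \<^typ>\<open>4\<close> the numeral \<open>4\<close> denotes the same element as \<open>0\<close>.\<close>

definition mat_unit :: "4 \<Rightarrow> 4 \<Rightarrow> complex^4^4" where
  "mat_unit i j = (\<chi> k l. if k = i \<and> l = j then 1 else 0)"

definition m_e10 :: "complex^4^4" where "m_e10 = mat_unit 1 2 - mat_unit 4 3"
definition m_f10 :: "complex^4^4" where "m_f10 = mat_unit 2 1 - mat_unit 3 4"
definition m_e01 :: "complex^4^4" where "m_e01 = mat_unit 3 1"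
definition m_f01 :: "complex^4^4" where "m_f01 = mat_unit 1 3"
definition m_h10 :: "complex^4^4" where
  "m_h10 = mat_unit 1 1 - mat_unit 2 2 - mat_unit 3 3 + mat_unit 4 4"
definition m_h01 :: "complex^4^4" where "m_h01 = - mat_unit 1 1 + mat_unit 3 3"
definition m_e11 :: "complex^4^4" where "m_e11 = - mat_unit 3 2 - mat_unit 4 1"
definition m_e21 :: "complex^4^4" where "m_e21 = cmat_scale 2 (mat_unit 4 2)"
definition m_f11 :: "complex^4^4" where "m_f11 = - mat_unit 1 4 - mat_unit 2 3"
definition m_f21 :: "complex^4^4" where "m_f21 = cmat_scale 2 (mat_unit 2 4)"

lemmas m_defs = m_e10_def m_f10_def m_e01_def m_f01_def m_h10_def m_h01_def
  m_e11_def m_e21_def m_f11_def m_f21_def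

definition c2_basis :: "(complex^4^4) set" where
  "c2_basis = {m_e10, m_f10, m_e01, m_f01, m_h10, m_h01, m_e11, m_e21, m_f11, m_f21}"

lemma mat_unit_nth: "mat_unit i j $ k $ l = (if k = i \<and> l = j then 1 else 0)"
  by (simp add: mat_unit_def)

lemma c2_span_iff:
  "A \<in> cmat.span c2_basis \<longleftrightarrow>
     A$3$3 = - A$1$1 \<and> A$3$4 = - A$2$1 \<and> A$4$3 = - A$1$2 \<and> A$4$4 = - A$2$2 \<and>
     A$1$4 = A$2$3 \<and> A$3$2 = A$4$1" (is "_ \<longleftrightarrow> ?P A")
proof
  assume "A \<in> cmat.span c2_basis"
  then show "?P A"
  proof (induction rule: cmat.span_induct_alt)
    case (step c x y)
    then show ?case
      by (auto simp: c2_basis_def m_defs mat_unit_nth cmat_scale_def)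
  qed simp
next
  assume P: "?P A"
  have eq: "A = cmat_scale (A$1$2) m_e10 + cmat_scale (A$2$1) m_f10
    + cmat_scale (A$3$1) m_e01 + cmat_scale (A$1$3) m_f01
    + cmat_scale (- A$2$2) m_h10 + cmat_scale (- A$1$1 - A$2$2) m_h01
    + cmat_scale (- A$4$1) m_e11 + cmat_scale (A$4$2 / 2) m_e21
    + cmat_scale (- A$2$3) m_f11 + cmat_scale (A$2$4 / 2) m_f21"
    using P by (simp add: vec_eq_iff forall_4 m_defs mat_unit_nth cmat_scale_def)
  show "A \<in> cmat.span c2_basis"
    by (subst eq) (intro cmat.span_add cmat.span_scale cmat.span_base; simp add: c2_basis_def)
qed

lemma c2_span_commutator:
  "A \<in> cmat.span c2_basis \<Longrightarrow> B \<in> cmat.span c2_basis \<Longrightarrow> commutator A B \<in> cmat.span c2_basis"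
  unfolding c2_span_iff commutator_def matrix_matrix_mult_def
  by (simp add: sum_4 algebra_simps)

typedef c2 = "cmat.span c2_basis"
  morphisms c2_matrix Abs_c2
  using cmat.span_zero by blast

setup_lifting type_definition_c2

instantiation c2 :: complex_lie_algebra
begin

lift_definition zero_c2 :: c2 is 0 by (rule cmat.span_zero)

lift_definition plus_c2 :: "c2 \<Rightarrow> c2 \<Rightarrow> c2" is "(+)" by (rule cmat.span_add)

lift_definition uminus_c2 :: "c2 \<Rightarrow> c2" is uminus by (rule cmat.span_neg)

lift_definition minus_c2 :: "c2 \<Rightarrow> c2 \<Rightarrow> c2" is "(-)" by (rule cmat.span_diff)

lift_definition lie_scale_c2 :: "complex \<Rightarrow> c2 \<Rightarrow> c2" is cmat_scale by (rule cmat.span_scale)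

lift_definition lie_bracket_c2 :: "c2 \<Rightarrow> c2 \<Rightarrow> c2" is commutator by (rule c2_span_commutator)

instance
proof
  fix x y z :: c2 and a :: complex
  show "lie_bracket (x + y) z = lie_bracket x z + lie_bracket y z"
    by transfer (simp add: commutator_def matrix_matrix_mult_def vec_eq_iff
        sum.distrib algebra_simps)
  show "lie_bracket x (y + z) = lie_bracket x y + lie_bracket x z"
    by transfer (simp add: commutator_def matrix_matrix_mult_def vec_eq_iff
        sum.distrib algebra_simps)
  show "lie_bracket (lie_scale a x) y = lie_scale a (lie_bracket x y)"
    by transfer (simp add: commutator_def cmat_scale_def matrix_matrix_mult_def vec_eq_iff
        sum_distrib_left algebra_simps)
  show "lie_bracket x (lie_scale a y) = lie_scale a (lie_bracket x y)"
    by transfer (simp add: commutator_def cmat_scale_def matrix_matrix_mult_def vec_eq_iff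
        sum_distrib_left algebra_simps)
  show "lie_bracket x x = 0"
    by transfer (simp add: commutator_def)
  show "lie_bracket x (lie_bracket y z) + lie_bracket y (lie_bracket z x)
          + lie_bracket z (lie_bracket x y) = 0"
    by transfer (simp add: commutator_def matrix_diff_ldistrib matrix_diff_rdistrib matrix_mul_assoc)
qed (transfer, simp add: algebra_simps)+

end

lift_definition e10 :: c2 is m_e10 by (rule cmat.span_base) (simp add: c2_basis_def)
lift_definition f10 :: c2 is m_f10 by (rule cmat.span_base) (simp add: c2_basis_def)
lift_definition e01 :: c2 is m_e01 by (rule cmat.span_base) (simp add: c2_basis_def)
lift_definition f01 :: c2 is m_f01 by (rule cmat.span_base) (simp add: c2_basis_def)
lift_definition h10 :: c2 is m_h10 by (rule cmat.span_base) (simp add: c2_basis_def)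
lift_definition h01 :: c2 is m_h01 by (rule cmat.span_base) (simp add: c2_basis_def)
lift_definition e11 :: c2 is m_e11 by (rule cmat.span_base) (simp add: c2_basis_def)
lift_definition e21 :: c2 is m_e21 by (rule cmat.span_base) (simp add: c2_basis_def)
lift_definition f11 :: c2 is m_f11 by (rule cmat.span_base) (simp add: c2_basis_def)
lift_definition f21 :: c2 is m_f21 by (rule cmat.span_base) (simp add: c2_basis_def)

definition cartan :: "c2 set" where
  "cartan = lie.span {h10, h01}"

definition U0 :: "c2 uea set" where
  "U0 = {u. \<forall>h\<in>cartan. uea_incl h * u = u * uea_incl h}"


section \<open>Words in the generators of $U_0$\<close>

datatype h_letter = H1 | H2

datatype c_letter = C1 | C2 | C3 | C4 | C5 | C6 | C7 | C8 | C9 | C10 | C11 | C12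

datatype letter = HL h_letter | CL c_letter

fun h_index :: "h_letter \<Rightarrow> nat" where
  "h_index H1 = 1" | "h_index H2 = 2"

fun c_index :: "c_letter \<Rightarrow> nat" where
  "c_index C1 = 1" | "c_index C2 = 2" | "c_index C3 = 3" | "c_index C4 = 4"
| "c_index C5 = 5" | "c_index C6 = 6" | "c_index C7 = 7" | "c_index C8 = 8"
| "c_index C9 = 9" | "c_index C10 = 10" | "c_index C11 = 11" | "c_index C12 = 12"

fun letter_less :: "letter \<Rightarrow> letter \<Rightarrow> bool" where
  "letter_less (HL a) (HL b) \<longleftrightarrow> h_index a < h_index b"
| "letter_less (HL a) (CL b) \<longleftrightarrow> True"
| "letter_less (CL a) (HL b) \<longleftrightarrow> False"
| "letter_less (CL a) (CL b) \<longleftrightarrow> c_index a < c_index b"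

fun h_elem :: "h_letter \<Rightarrow> c2" where
  "h_elem H1 = h01" | "h_elem H2 = h10"

fun c_word :: "c_letter \<Rightarrow> c2 list" where
  "c_word C1 = [f01, e01]"
| "c_word C2 = [f21, e21]"
| "c_word C3 = [f10, e10]"
| "c_word C4 = [f11, e11]"
| "c_word C5 = [f11, e01, e10]"
| "c_word C6 = [f10, f01, e11]"
| "c_word C7 = [f21, e11, e10]"
| "c_word C8 = [f10, f11, e21]"
| "c_word C9 = [f21, e01, e10, e10]"
| "c_word C10 = [f10, f10, f01, e21]"
| "c_word C11 = [f01, f21, e11, e11]"
| "c_word C12 = [f11, f11, e21, e01]"

fun letter_word :: "letter \<Rightarrow> c2 list" where
  "letter_word (HL h) = [h_elem h]"
| "letter_word (CL c) = c_word c"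

definition omega :: "letter list \<Rightarrow> c2 list" where
  "omega Y = concat (map letter_word Y)"

definition equivalent :: "letter list \<Rightarrow> letter list \<Rightarrow> bool" where
  "equivalent Y Y' \<longleftrightarrow> mset (omega Y) = mset (omega Y')"

definition semi_perfect :: "letter list \<Rightarrow> bool" where
  "semi_perfect Y \<longleftrightarrow>
     (\<forall>Y'. equivalent Y Y' \<and> Y' \<noteq> Y \<longrightarrow> (Y, Y') \<in> lexord {(x, y). letter_less x y})"


section \<open>The algebra $F$ and the ideal of relations\<close>

text \<open>
  Coefficients are polynomials in \<open>h\<^sub>1\<close>, \<open>h\<^sub>2\<close>, represented as finitely supported maps from
  exponent vectors to complex numbers.
\<close>

type_synonym h_poly = "(h_letter \<Rightarrow>\<^sub>0 nat) \<Rightarrow>\<^sub>0 complex"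

type_synonym F = "c_letter list \<Rightarrow>\<^sub>0 h_poly"

definition F_scale :: "complex \<Rightarrow> F \<Rightarrow> F" where
  "F_scale a X = Poly_Mapping.single [] (Poly_Mapping.single 0 a) * X"

interpretation F: vector_space F_scale
proof
  fix a b :: complex and x y :: F
  show "F_scale a (x + y) = F_scale a x + F_scale a y"
    by (simp add: F_scale_def algebra_simps)
  show "F_scale (a + b) x = F_scale a x + F_scale b x"
    by (simp add: F_scale_def single_add algebra_simps)
  show "F_scale a (F_scale b x) = F_scale (a * b) x"
    by (simp add: F_scale_def mult_single plus_list_def flip: mult.assoc)
  show "F_scale 1 x = x"
    by (simp add: F_scale_def single_one flip: zero_list_def)
qed

definition hF :: "h_letter \<Rightarrow> F" where
  "hF h = Poly_Mapping.single [] (Poly_Mapping.single (Poly_Mapping.single h 1) 1)"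

definition cF :: "c_letter \<Rightarrow> F" where
  "cF c = Poly_Mapping.single [c] 1"

fun letter_F :: "letter \<Rightarrow> F" where
  "letter_F (HL h) = hF h"
| "letter_F (CL c) = cF c"

definition word_F :: "letter list \<Rightarrow> F" where
  "word_F Y = prod_list (map letter_F Y)"

definition h_poly_value :: "h_poly \<Rightarrow> c2 uea" where
  "h_poly_value p = (\<Sum>m\<in>Poly_Mapping.keys p. uea_scale (Poly_Mapping.lookup p m)
     (uea_incl (h_elem H1) ^ Poly_Mapping.lookup m H1 * uea_incl (h_elem H2) ^ Poly_Mapping.lookup m H2))"

definition c_value :: "c_letter \<Rightarrow> c2 uea" where
  "c_value c = prod_list (map uea_incl (c_word c))"

text \<open>The natural surjection of \<open>F\<close> onto \<open>U\<^sub>0\<close>, as a map into the enveloping algebra.\<close>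

definition to_U :: "F \<Rightarrow> c2 uea" where
  "to_U X = (\<Sum>w\<in>Poly_Mapping.keys X. h_poly_value (Poly_Mapping.lookup X w) * prod_list (map c_value w))"

definition K_ideal :: "F set" where
  "K_ideal = {X. to_U X = 0}"

definition normal_form :: "F \<Rightarrow> F" where
  "normal_form X = (THE Y. Y \<in> F.span (word_F ` {Y. semi_perfect Y}) \<and> to_U Y = to_U X)"

definition reduction_relation :: "c_letter list \<Rightarrow> F" where
  "reduction_relation w =
     prod_list (map cF w) - normal_form (prod_list (map cF w))"

definition K' :: "F set" where
  "K' = {reduction_relation w | w. length w \<le> 4}"

text \<open>
  \<open>Len\<close> is a relation rather than a function: \<open>0\<close> arises as \<^const>\<open>reduction_relation\<close> of
  semi-perfect words of several lengths.
\<close>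

definition has_Len :: "F \<Rightarrow> nat \<Rightarrow> bool" where
  "has_Len X m \<longleftrightarrow> (\<exists>w. length w = m \<and> m \<le> 4 \<and> X = reduction_relation w)"

definition K_tilde :: "F set" where
  "K_tilde = {X \<in> K'. has_Len X 2}"

definition E_pairs :: "(c_letter \<times> c_letter) set" where
  "E_pairs = {(C5, C9), (C5, C12), (C6, C10), (C6, C11), (C7, C9), (C7, C11), (C8, C10), (C8, C12)}"

definition P_monomials :: "F set" where
  "P_monomials = {hF H1 ^ s1 * hF H2 ^ s2 * cF C1 ^ s3 * cF C2 ^ s4 * cF C3 ^ s5 * cF C4 ^ s6
          * cF m ^ sm * cF n ^ sn | s1 s2 s3 s4 s5 s6 m n sm sn. (m, n) \<in> E_pairs}"

end

theory Submission
  imports Defs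
begin

text \<open>
  Words in the ten basis vectors of the Lie algebra span its enveloping algebra, and a permutation
  of the letters of a word changes its value only by shorter words of the same weight.  A suitable
  element of the Cartan subalgebra acts on each word by its weight, so that the centralizer \<open>U\<^sub>0\<close> is
  spanned by the words of weight zero (\<open>U0_zero_weight_part\<close>).

  A multiset of letters of weight zero is determined by the numbers of Cartan letters, the numbers
  of pairs of opposite root vectors, and the surplus of positive over negative root vectors for
  each positive root.  The surpluses form a lattice of rank two, which the sign changes divide into
  eight sectors.  Their boundary rays are the generators \<open>c\<^sub>5\<close> to \<open>c\<^sub>1\<^sub>2\<close>, and the pairs of rays
  bounding a sector are the elements of \<open>E\<close>.  Thus every such multiset is represented by a word
  in \<open>P\<close> (\<open>toric_factorization\<close>), and this word is lexicographically minimal among the words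
  representing it (\<open>admissible_minimal\<close>).  Hence the semi-perfect words are those of \<open>P\<close>, and by
  induction on the length their values span \<open>U\<^sub>0\<close>.

  For linear independence it has to be shown that words with different multisets of letters
  remain independent in the enveloping algebra.  The matrix coefficients of the defining
  representation provide functionals dual to the basis, and the
  shuffle products of these functionals separate words, as monomials are separated by the leading
  terms of products of coordinate functions at the identity of a Lie group
  (\<open>word_values_independent\<close>).

  As to the relations, a product of two generators equals the semi-perfect word with the same root
  vectors up to words of lower degree.  So the relations of length two permit, up to lower
  degree, to exchange letters and to replace two ray generators that do not bound a common sector by
  a word in which ray generators account for less of the degree.  This reduces every word to
  semi-perfect ones (\<open>word_F_reduces\<close>), and linear independence turns the reduction of a relation
  into zero.
\<close>

section \<open>Maps determined by their values on a basis\<close>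

definition linear_extension ::
    "('b \<Rightarrow> 'a::ab_group_add \<Rightarrow> 'c::ab_group_add) \<Rightarrow> ('b \<Rightarrow>\<^sub>0 'a) \<Rightarrow> 'c" where
  "linear_extension g X = (\<Sum>k\<in>Poly_Mapping.keys X. g k (Poly_Mapping.lookup X k))"

lemma linear_extension_superset:
  assumes "\<And>k. g k 0 = 0" and "finite S" and "Poly_Mapping.keys X \<subseteq> S"
  shows "linear_extension g X = (\<Sum>k\<in>S. g k (Poly_Mapping.lookup X k))"
  unfolding linear_extension_def
  by (rule sum.mono_neutral_left) (use assms in \<open>auto simp: in_keys_iff\<close>)

lemma additive_zero:
  fixes g :: "'a::ab_group_add \<Rightarrow> 'c::ab_group_add"
  assumes "\<And>a b. g (a + b) = g a + g b"
  shows "g 0 = 0"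
  using assms[of 0 0] by simp

lemma linear_extension_add:
  assumes "\<And>k a b. g k (a + b) = g k a + g k b"
  shows "linear_extension g (X + Y) = linear_extension g X + linear_extension g Y"
proof -
  let ?S = "Poly_Mapping.keys X \<union> Poly_Mapping.keys Y"
  have z: "g k 0 = 0" for k using assms by (rule additive_zero)
  have "linear_extension g (X + Y) = (\<Sum>k\<in>?S. g k (Poly_Mapping.lookup (X + Y) k))"
    by (rule linear_extension_superset) (use Poly_Mapping.keys_add[of X Y] z in auto)
  also have "\<dots> = (\<Sum>k\<in>?S. g k (Poly_Mapping.lookup X k)) + (\<Sum>k\<in>?S. g k (Poly_Mapping.lookup Y k))"
    by (simp add: lookup_add assms sum.distrib)
  also have "\<dots> = linear_extension g X + linear_extension g Y"
    by (subst (1 2) linear_extension_superset[where S = ?S]) (use z in auto)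
  finally show ?thesis .
qed

lemma linear_extension_single:
  assumes "g k 0 = 0"
  shows "linear_extension g (Poly_Mapping.single k a) = g k a"
  using assms by (cases "a = 0") (simp_all add: linear_extension_def)

lemma linear_extension_zero [simp]: "linear_extension g 0 = 0"
  by (simp add: linear_extension_def)

lemma linear_extension_diff:
  fixes X Y :: "'b \<Rightarrow>\<^sub>0 'a::ab_group_add"
  assumes "\<And>k a b. g k (a + b) = g k a + g k b"
  shows "linear_extension g (X - Y) = linear_extension g X - linear_extension g Y"
proof -
  have "linear_extension g (X - Y + Y) = linear_extension g (X - Y) + linear_extension g Y"
    by (rule linear_extension_add) (rule assms)
  then show ?thesis by (simp add: algebra_simps)
qed

lemma linear_extension_sum:
  assumes "\<And>k a b. g k (a + b) = g k a + g k b"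
  shows "linear_extension g (sum X S) = (\<Sum>i\<in>S. linear_extension g (X i))"
  by (induction S rule: infinite_finite_induct) (simp_all add: linear_extension_add assms)

lemma poly_mapping_single_induct [case_names zero add]:
  fixes X :: "'b \<Rightarrow>\<^sub>0 'a::ab_group_add"
  assumes "P 0" and "\<And>k a X. P X \<Longrightarrow> P (Poly_Mapping.single k a + X)"
  shows "P X"
proof -
  have sum: "P (\<Sum>k\<in>S. Poly_Mapping.single k (Poly_Mapping.lookup X k))" for S
    by (induction S rule: infinite_finite_induct) (use assms in auto)
  have "(\<Sum>k\<in>Poly_Mapping.keys X. Poly_Mapping.single k (Poly_Mapping.lookup X k)) = X"
    by (rule poly_mapping_eqI) (auto simp: lookup_sum lookup_single when_def in_keys_iff sum.delta)
  then show ?thesis using sum[of "Poly_Mapping.keys X"] by simp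
qed

text \<open>
  The products on both sides are bilinear, so it suffices to compare them on monomials.
  The lemma serves twice: for polynomials in the Cartan generators, and for the free algebra over
  these polynomials.
\<close>

lemma linear_extension_mult:
  fixes g :: "'b::monoid_add \<Rightarrow> 'a::ring_1 \<Rightarrow> 'c::ring_1"
  assumes add: "\<And>k a b. g k (a + b) = g k a + g k b"
    and mult: "\<And>k l a b. g (k + l) (a * b) = g k a * g l b"
  shows "linear_extension g (X * Y) = linear_extension g X * linear_extension g Y"
proof -
  have z: "g k 0 = 0" for k using add by (rule additive_zero)
  have s: "linear_extension g (Poly_Mapping.single k a * Y)
      = g k a * linear_extension g Y" for k a
    by (induction Y rule: poly_mapping_single_induct)
      (simp_all add: distrib_left linear_extension_add[of g, OF add] mult_single
        linear_extension_single z mult)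
  show ?thesis
    by (induction X rule: poly_mapping_single_induct)
      (simp_all add: distrib_right linear_extension_add[of g, OF add] linear_extension_single z s)
qed


section \<open>Words with values in an enveloping algebra\<close>

definition word_value :: "'a::complex_lie_algebra list \<Rightarrow> 'a uea" where
  "word_value w = prod_list (map uea_incl w)"

lemma word_value_simps [simp]:
  "word_value [] = 1" "word_value (x # w) = uea_incl x * word_value w"
  "word_value (v @ w) = word_value v * word_value w"
  by (simp_all add: word_value_def)

lemma abs_uea_eq_0_iff: "abs_uea x = 0 \<longleftrightarrow> x \<in> uea_ideal"
  by (simp add: zero_uea_def uea.abs_eq_iff uea_rel_def)

lemma word_value_eq: "word_value w = abs_uea (Poly_Mapping.single w 1)"
proof (induction w)
  case Nil
  show ?case by (simp add: one_uea_def zero_list_def flip: single_one)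
next
  case (Cons x w)
  then show ?case
    by (simp add: uea_incl.abs_eq times_uea.abs_eq free_letter_def mult_single plus_list_def)
qed

lemma abs_uea_single: "abs_uea (Poly_Mapping.single w a) = uea_scale a (word_value w)"
  by (simp add: word_value_eq uea_scale.abs_eq free_const_def mult_single plus_list_def)

lemma abs_uea_sum: "abs_uea (sum x S) = (\<Sum>i\<in>S. abs_uea (x i))"
  by (induction S rule: infinite_finite_induct)
    (simp_all add: zero_uea_def flip: plus_uea.abs_eq)

lemma uea_in_span_words: "u \<in> uea.span (range word_value)"
proof (induction u rule: uea.abs_induct)
  fix x :: "'a list \<Rightarrow>\<^sub>0 complex"
  show "abs_uea x \<in> uea.span (range word_value)"
  proof (induction x rule: poly_mapping_single_induct)
    case zero
    show ?case using uea.span_zero by (simp add: zero_uea_def)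
  next
    case (add w a x)
    then show ?case
      unfolding plus_uea.abs_eq[symmetric] abs_uea_single
      by (intro uea.span_add[OF uea.span_scale[OF uea.span_base[OF rangeI]]])
  qed
qed

lemma uea_scale_mult_left: "uea_scale a x * y = uea_scale a (x * y)"
  by transfer (simp add: uea_rel_def uea_ideal_zero mult.assoc)

lemma free_const_commute: "free_const c * x = x * free_const c"
proof (induction x rule: poly_mapping_single_induct)
  case (add k a X)
  then show ?case
    by (simp add: distrib_left distrib_right free_const_def mult_single plus_list_def mult.commute)
qed simp

lemma uea_scale_mult_right: "x * uea_scale a y = uea_scale a (x * y)"
  by transfer (simp add: uea_rel_def uea_ideal_zero free_const_commute mult.assoc
      flip: mult.assoc[of _ "free_const _"])

lemma uea_ideal_base: "x \<in> uea_relations \<Longrightarrow> x \<in> uea_ideal"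
  unfolding uea_ideal_def by (rule hull_inc)

lemma uea_incl_add: "uea_incl (x + y) = uea_incl x + uea_incl y"
proof (transfer, unfold uea_rel_def diff_diff_eq[symmetric])
  fix x y :: 'a
  show "free_letter (x + y) - free_letter x - free_letter y \<in> uea_ideal"
    by (rule uea_ideal_base) (unfold uea_relations_def, blast)
qed

lemma uea_incl_scale: "uea_incl (lie_scale c x) = uea_scale c (uea_incl x)"
proof (transfer, unfold uea_rel_def)
  fix c and x :: 'a
  show "free_letter (lie_scale c x) - free_const c * free_letter x \<in> uea_ideal"
    by (rule uea_ideal_base) (unfold uea_relations_def, blast)
qed

lemma uea_incl_bracket:
  "uea_incl x * uea_incl y - uea_incl y * uea_incl x = uea_incl (lie_bracket x y)"
proof (transfer, unfold uea_rel_def)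
  fix x y :: 'a
  show "free_letter x * free_letter y - free_letter y * free_letter x
      - free_letter (lie_bracket x y) \<in> uea_ideal"
    by (rule uea_ideal_base) (unfold uea_relations_def, blast)
qed

lemma uea_incl_zero: "uea_incl 0 = 0"
  using uea_incl_add[of 0 0] by simp

lemma uea_incl_sum:
  "uea_incl (\<Sum>b\<in>S. lie_scale (c b) b) = (\<Sum>b\<in>S. uea_scale (c b) (uea_incl b))"
  by (induction S rule: infinite_finite_induct)
    (simp_all add: uea_incl_zero uea_incl_add uea_incl_scale)

section \<open>Functionals on words and their shuffle product\<close>

text \<open>
  These are the linear functionals on the enveloping algebra, given by their values on words:
  the three conditions say that the linear extension to the free algebra kills each generator of
  the defining ideal between any two words.
\<close>

definition lie_functional :: "('a::complex_lie_algebra list \<Rightarrow> complex) \<Rightarrow> bool" where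
  "lie_functional f \<longleftrightarrow>
     (\<forall>u v x y. f (u @ (x + y) # v) = f (u @ x # v) + f (u @ y # v)) \<and>
     (\<forall>u v c x. f (u @ lie_scale c x # v) = c * f (u @ x # v)) \<and>
     (\<forall>u v x y. f (u @ x # y # v) - f (u @ y # x # v) = f (u @ lie_bracket x y # v))"

definition on_free :: "('a list \<Rightarrow> complex) \<Rightarrow> ('a list \<Rightarrow>\<^sub>0 complex) \<Rightarrow> complex" where
  "on_free f = linear_extension (\<lambda>w a. a * f w)"

lemma on_free_simps:
  "on_free f 0 = 0" "on_free f (x + y) = on_free f x + on_free f y"
  "on_free f (x - y) = on_free f x - on_free f y"
  "on_free f (Poly_Mapping.single w a) = a * f w"
  by (simp_all add: on_free_def linear_extension_add linear_extension_diff
      linear_extension_single distrib_right)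

lemma on_free_mult_left:
  "on_free f (Poly_Mapping.single u a * x) = a * on_free (\<lambda>w. f (u @ w)) x"
  by (induction x rule: poly_mapping_single_induct)
    (simp_all add: on_free_simps distrib_left mult_single plus_list_def)

lemma on_free_mult_right:
  "on_free f (x * Poly_Mapping.single u a) = a * on_free (\<lambda>w. f (w @ u)) x"
  by (induction x rule: poly_mapping_single_induct)
    (simp_all add: on_free_simps distrib_left distrib_right mult_single plus_list_def)

text \<open>
  The elements that \<open>f\<close> kills after multiplication by arbitrary words on both sides form a
  two-sided ideal, and \<^const>\<open>lie_functional\<close> puts the defining relations into it.
\<close>

lemma lie_functional_vanishes_on_ideal:
  assumes f: "lie_functional f" and x: "x \<in> uea_ideal"
  shows "on_free f x = 0"
proof -
  let ?I = "{x. \<forall>u v. on_free (\<lambda>w. f (u @ w @ v)) x = 0}"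
  have left: "a * x \<in> ?I" if "x \<in> ?I" for a x
    using that
    by (induction a rule: poly_mapping_single_induct)
      (auto simp: distrib_right on_free_simps on_free_mult_left simp flip: append_assoc)
  have right: "x * a \<in> ?I" if "x \<in> ?I" for a x
    using that
    by (induction a rule: poly_mapping_single_induct)
      (auto simp: distrib_left on_free_simps on_free_mult_right)
  have "two_sided_ideal ?I"
    unfolding two_sided_ideal_def using left right by (auto simp: on_free_simps)
  moreover have "uea_relations \<subseteq> ?I"
  proof -
    note f' = f[unfolded lie_functional_def]
    have "f (u @ (x + y) # v) = f (u @ x # v) + f (u @ y # v)"
      "f (u @ lie_scale c x # v) = c * f (u @ x # v)"
      "f (u @ lie_bracket x y # v) = f (u @ x # y # v) - f (u @ y # x # v)" for u v x y c
      using f' by simp_all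
    then show ?thesis
      unfolding uea_relations_def
      by (intro Un_least subsetI; elim CollectE exE conjE; hypsubst; intro CollectI allI)
        (simp_all add: free_letter_def free_const_def on_free_simps mult_single plus_list_def)
  qed
  ultimately have "uea_ideal \<subseteq> ?I"
    unfolding uea_ideal_def by (rule hull_minimal[rotated])
  then have "on_free (\<lambda>w. f ([] @ w @ [])) x = 0" using x by blast
  then show ?thesis by simp
qed

text \<open>
  This is the product of functionals that is dual to the coproduct making every letter primitive:
  its value on a word sums over all ways to split the word into two subwords, one for each factor.
  The recursion states that prepending a letter to the argument is a derivation.
\<close>

fun shuffle_product :: "('a list \<Rightarrow> complex) \<Rightarrow> ('a list \<Rightarrow> complex) \<Rightarrow> 'a list \<Rightarrow> complex" where
  "shuffle_product f g [] = f [] * g []"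
| "shuffle_product f g (x # w) =
     shuffle_product (\<lambda>v. f (x # v)) g w + shuffle_product f (\<lambda>v. g (x # v)) w"

lemma shuffle_product_add:
  "shuffle_product (\<lambda>v. f v + f' v) g w = shuffle_product f g w + shuffle_product f' g w"
  "shuffle_product f (\<lambda>v. g v + g' v) w = shuffle_product f g w + shuffle_product f g' w"
  by (induction w arbitrary: f f' g g') (simp_all add: algebra_simps)

lemma shuffle_product_diff:
  "shuffle_product (\<lambda>v. f v - f' v) g w = shuffle_product f g w - shuffle_product f' g w"
  "shuffle_product f (\<lambda>v. g v - g' v) w = shuffle_product f g w - shuffle_product f g' w"
  by (induction w arbitrary: f f' g g') (simp_all add: algebra_simps)

lemma shuffle_product_scale:
  "shuffle_product (\<lambda>v. c * f v) g w = c * shuffle_product f g w"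
  "shuffle_product f (\<lambda>v. c * g v) w = c * shuffle_product f g w"
  by (induction w arbitrary: f g) (simp_all add: algebra_simps)

lemma lie_functional_Cons: "lie_functional f \<Longrightarrow> lie_functional (\<lambda>v. f (a # v))"
  unfolding lie_functional_def by (metis append_Cons)

lemma lie_functional_head:
  assumes "lie_functional f"
  shows "f ((x + y) # v) = f (x # v) + f (y # v)"
    and "f (lie_scale c x # v) = c * f (x # v)"
    and "f (lie_bracket x y # v) = f (x # y # v) - f (y # x # v)"
  using assms unfolding lie_functional_def by (metis append_Nil)+

text \<open>
  Below a common prefix the conditions only concern the operators \<open>f \<mapsto> (\<lambda>v. f (x # v))\<close>.
  These are derivations of the shuffle product, and sums, multiples and commutators of
  derivations are derivations.
\<close>

lemma lie_functional_shuffle_product: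
  assumes "lie_functional f" and "lie_functional g"
  shows "lie_functional (shuffle_product f g)"
proof -
  have add: "shuffle_product f g (u @ (x + y) # v)
      = shuffle_product f g (u @ x # v) + shuffle_product f g (u @ y # v)" for u v x y
    using assms
  proof (induction u arbitrary: f g)
    case Nil
    then show ?case by (simp add: lie_functional_head shuffle_product_add)
  qed (simp add: lie_functional_Cons)
  have scale: "shuffle_product f g (u @ lie_scale c x # v) = c * shuffle_product f g (u @ x # v)"
    for u v c x
    using assms
  proof (induction u arbitrary: f g)
    case Nil
    then show ?case by (simp add: lie_functional_head shuffle_product_scale algebra_simps)
  qed (simp add: lie_functional_Cons algebra_simps)
  have bracket: "shuffle_product f g (u @ x # y # v) - shuffle_product f g (u @ y # x # v)
      = shuffle_product f g (u @ lie_bracket x y # v)" for u v x y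
    using assms
  proof (induction u arbitrary: f g)
    case Nil
    then show ?case by (simp add: lie_functional_head shuffle_product_diff algebra_simps)
  next
    case (Cons a u)
    show ?case
      using Cons.IH[OF lie_functional_Cons[OF Cons.prems(1)] Cons.prems(2), of a]
        Cons.IH[OF Cons.prems(1) lie_functional_Cons[OF Cons.prems(2)], of a]
      by (simp add: algebra_simps)
  qed
  show ?thesis unfolding lie_functional_def using add scale bracket by blast
qed

text \<open>
  Vanishing on all words shorter than \<open>k\<close> is the analogue of vanishing to order \<open>k\<close> at the
  identity of a Lie group, and orders of vanishing add up in a product.
\<close>

lemma shuffle_product_below_order:
  assumes "\<And>v. length v < j \<Longrightarrow> f v = 0" and "\<And>v. length v < k \<Longrightarrow> g v = 0"
    and "length w < j + k"
  shows "shuffle_product f g w = 0"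
  using assms
proof (induction w arbitrary: f g j k)
  case Nil
  then show ?case by (cases "j = 0") auto
next
  case (Cons x w)
  have "shuffle_product (\<lambda>v. f (x # v)) g w = 0"
    by (cases "j = 0", rule Cons.IH[of 0 _ k], use Cons.prems in auto)
      (rule Cons.IH[of "j - 1" _ k], use Cons.prems in auto)
  moreover have "shuffle_product f (\<lambda>v. g (x # v)) w = 0"
    by (cases "k = 0", rule Cons.IH[of j _ 0], use Cons.prems in auto)
      (rule Cons.IH[of j _ "k - 1"], use Cons.prems in auto)
  ultimately show ?case by simp
qed

lemma shuffle_product_leading_right:
  assumes "\<And>v. length v < length w \<Longrightarrow> g v = 0"
  shows "shuffle_product f g w = f [] * g w"
  using assms
proof (induction w arbitrary: g)
  case (Cons x w)
  have "shuffle_product (\<lambda>v. f (x # v)) g w = 0"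
    by (rule shuffle_product_below_order[of 0 _ "Suc (length w)"]) (use Cons.prems in auto)
  with Cons show ?case by simp
qed simp

text \<open>
  In lowest order only those splittings contribute that give a single letter to the factor of
  order one.
\<close>

lemma shuffle_product_leading:
  assumes "f [] = 0" and "\<And>v. length v < k \<Longrightarrow> g v = 0" and "length w = Suc k"
  shows "shuffle_product f g w = (\<Sum>i<length w. f [w ! i] * g (take i w @ drop (Suc i) w))"
  using assms
proof (induction w arbitrary: g k)
  case (Cons x w)
  have 1: "shuffle_product (\<lambda>v. f (x # v)) g w = f [x] * g w"
    by (rule shuffle_product_leading_right) (use Cons.prems in auto)
  have 2: "shuffle_product f (\<lambda>v. g (x # v)) w
      = (\<Sum>i<length w. f [w ! i] * g (x # take i w @ drop (Suc i) w))"
  proof (cases k)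
    case 0
    then show ?thesis using Cons.prems by simp
  next
    case (Suc k')
    show ?thesis by (rule Cons.IH[of k']) (use Cons.prems Suc in auto)
  qed
  show ?case by (simp add: 1 2 sum.lessThan_Suc_shift del: sum.lessThan_Suc)
qed simp

fun shuffle_list :: "('a list \<Rightarrow> complex) list \<Rightarrow> 'a list \<Rightarrow> complex" where
  "shuffle_list [] = (\<lambda>w. if w = [] then 1 else 0)"
| "shuffle_list (f # fs) = shuffle_product f (shuffle_list fs)"

lemma lie_functional_shuffle_list:
  "(\<And>f. f \<in> set fs \<Longrightarrow> lie_functional f) \<Longrightarrow> lie_functional (shuffle_list fs)"
proof (induction fs)
  case Nil
  show ?case by (simp add: lie_functional_def)
qed (simp add: lie_functional_shuffle_product)

lemma shuffle_list_below_order: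
  assumes "\<And>f. f \<in> set fs \<Longrightarrow> f [] = 0" and "length w < length fs"
  shows "shuffle_list fs w = 0"
  using assms
proof (induction fs arbitrary: w)
  case (Cons f fs)
  have "shuffle_product f (shuffle_list fs) w = 0"
    by (rule shuffle_product_below_order[of 1 _ "length fs"]) (use Cons in auto)
  then show ?case by simp
qed simp

text \<open>
  The value counts the bijections from the positions of \<open>w\<close> to those of \<open>bs\<close> that preserve
  letters.  Such bijections exist exactly if \<open>w\<close> is a rearrangement of \<open>bs\<close>.
\<close>

lemma shuffle_list_leading:
  assumes zero: "\<And>b. b \<in> B \<Longrightarrow> d b [] = 0"
    and dual: "\<And>b b'. b \<in> B \<Longrightarrow> b' \<in> B \<Longrightarrow> d b [b'] = (if b' = b then 1 else 0)"
    and "set bs \<subseteq> B" and "set w \<subseteq> B" and "length w = length bs"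
  shows "\<exists>n::nat. shuffle_list (map d bs) w = of_nat n \<and> (n > 0 \<longleftrightarrow> mset w = mset bs)"
  using assms(3-)
proof (induction bs arbitrary: w)
  case Nil
  then show ?case by (intro exI[of _ 1]) simp
next
  case (Cons b bs)
  let ?del = "\<lambda>i. take i w @ drop (Suc i) w"
  have mset_del: "mset w = add_mset (w ! i) (mset (?del i))" if "i < length w" for i
  proof -
    have "mset w = mset (take i w @ w ! i # drop (Suc i) w)"
      by (rule arg_cong[OF id_take_nth_drop[OF that]])
    then show ?thesis by simp
  qed
  have "\<forall>i. \<exists>n::nat. i < length w \<longrightarrow>
      shuffle_list (map d bs) (?del i) = of_nat n \<and> (n > 0 \<longleftrightarrow> mset (?del i) = mset bs)"
  proof
    fix i
    show "\<exists>n::nat. i < length w \<longrightarrow>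
      shuffle_list (map d bs) (?del i) = of_nat n \<and> (n > 0 \<longleftrightarrow> mset (?del i) = mset bs)"
    proof (cases "i < length w")
      case True
      have "set (?del i) \<subseteq> B"
        using Cons.prems(2) set_take_subset[of i w] set_drop_subset[of "Suc i" w] by auto
      then show ?thesis using Cons.IH[of "?del i"] Cons.prems True by simp
    qed simp
  qed
  from choice[OF this] obtain n where
    n: "\<And>i. i < length w \<Longrightarrow> shuffle_list (map d bs) (?del i) = of_nat (n i)"
      "\<And>i. i < length w \<Longrightarrow> n i > 0 \<longleftrightarrow> mset (?del i) = mset bs"
    by blast
  have wB: "w ! i \<in> B" if "i < length w" for i
    using nth_mem[OF that] Cons.prems(2) by blast
  have bB: "b \<in> B" and bsB: "set bs \<subseteq> B" using Cons.prems by auto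
  let ?N = "\<Sum>i<length w. if w ! i = b then n i else 0"
  have "shuffle_list (map d (b # bs)) w
      = (\<Sum>i<length w. d b [w ! i] * shuffle_list (map d bs) (?del i))"
    unfolding list.map shuffle_list.simps
    by (rule shuffle_product_leading[where k = "length bs"])
      (use Cons.prems bsB bB zero in \<open>auto intro!: shuffle_list_below_order simp: subset_iff\<close>)
  also have "\<dots> = of_nat ?N"
    unfolding of_nat_sum by (intro sum.cong refl) (simp add: dual[OF bB wB] n(1))
  finally have eq: "shuffle_list (map d (b # bs)) w = of_nat ?N" .
  have "?N > 0 \<longleftrightarrow> (\<exists>i<length w. w ! i = b \<and> mset (?del i) = mset bs)"
  proof -
    have "?N > 0 \<longleftrightarrow> (\<exists>i<length w. w ! i = b \<and> n i > 0)"
      unfolding neq0_conv[symmetric] sum_eq_0_iff[OF finite_lessThan] by auto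
    then show ?thesis using n(2) by blast
  qed
  also have "\<dots> \<longleftrightarrow> mset w = mset (b # bs)"
  proof
    assume "mset w = mset (b # bs)"
    then have "b \<in> set w" using mset_eq_setD by fastforce
    then obtain i where "i < length w" "w ! i = b" by (auto simp: in_set_conv_nth)
    with mset_del[of i] \<open>mset w = mset (b # bs)\<close>
    show "\<exists>i<length w. w ! i = b \<and> mset (?del i) = mset bs" by auto
  qed (use mset_del in auto)
  finally have "?N > 0 \<longleftrightarrow> mset w = mset (b # bs)" .
  with eq show ?case by (intro exI[of _ ?N] conjI)
qed

text \<open>
  This is the part of the Poincare-Birkhoff-Witt theorem that asserts linear independence, with
  a dual system of functionals as the only input.  Among the words with a nonzero coefficient take
  a longest one and form the shuffle product of the functionals dual to its letters.  It kills
  shorter words because of its order, and words of the same length with other letters by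
  \<open>shuffle_list_leading\<close>, so that only the chosen word survives.
\<close>

theorem word_values_independent:
  fixes word :: "'i \<Rightarrow> 'a::complex_lie_algebra list"
  assumes lie: "\<And>b. b \<in> B \<Longrightarrow> lie_functional (d b)"
    and zero: "\<And>b. b \<in> B \<Longrightarrow> d b [] = 0"
    and dual: "\<And>b b'. b \<in> B \<Longrightarrow> b' \<in> B \<Longrightarrow> d b [b'] = (if b' = b then 1 else 0)"
    and S: "finite S" and words: "\<And>i. i \<in> S \<Longrightarrow> set (word i) \<subseteq> B"
    and inj: "inj_on (\<lambda>i. mset (word i)) S"
    and sum0: "(\<Sum>i\<in>S. uea_scale (a i) (word_value (word i))) = 0"
    and i: "i \<in> S"
  shows "a i = 0"
proof (rule ccontr)
  assume "a i \<noteq> 0"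
  let ?T = "{i \<in> S. a i \<noteq> 0}"
  have fin: "finite ((\<lambda>i. length (word i)) ` ?T)" and ne: "?T \<noteq> {}" using S i \<open>a i \<noteq> 0\<close> by auto
  then obtain j where j: "j \<in> ?T" and max: "\<And>i. i \<in> ?T \<Longrightarrow> length (word i) \<le> length (word j)"
  proof -
    have "Max ((\<lambda>i. length (word i)) ` ?T) \<in> (\<lambda>i. length (word i)) ` ?T"
      by (rule Max_in) (use fin ne in auto)
    then obtain j where "j \<in> ?T" "Max ((\<lambda>i. length (word i)) ` ?T) = length (word j)" by blast
    moreover have "length (word i) \<le> Max ((\<lambda>i. length (word i)) ` ?T)" if "i \<in> ?T" for i
      by (rule Max_ge) (use fin that in blast)+
    ultimately show thesis using that by auto
  qed
  let ?\<phi> = "shuffle_list (map d (word j))"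
  have jB: "set (word j) \<subseteq> B" using j words by auto
  let ?x = "\<Sum>i\<in>S. Poly_Mapping.single (word i) (a i)"
  have "abs_uea ?x = 0" using sum0 by (simp add: abs_uea_sum abs_uea_single)
  then have "on_free ?\<phi> ?x = 0"
    unfolding abs_uea_eq_0_iff
    by (intro lie_functional_vanishes_on_ideal lie_functional_shuffle_list) (use lie jB in auto)
  then have "(\<Sum>i\<in>S. a i * ?\<phi> (word i)) = 0"
    by (simp add: on_free_def linear_extension_sum linear_extension_single distrib_right)
  also have "(\<Sum>i\<in>S. a i * ?\<phi> (word i)) = (\<Sum>i\<in>S. if i = j then a j * ?\<phi> (word j) else 0)"
  proof (intro sum.cong refl)
    fix i assume i: "i \<in> S"
    consider "i = j" | "a i = 0" | "length (word i) < length (word j)" "i \<noteq> j"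
      | "length (word i) = length (word j)" "i \<noteq> j" "a i \<noteq> 0"
      using max[of i] i by force
    then show "a i * ?\<phi> (word i) = (if i = j then a j * ?\<phi> (word j) else 0)"
    proof cases
      case 2
      then show ?thesis using j by auto
    next
      case 3
      have "?\<phi> (word i) = 0"
        by (rule shuffle_list_below_order) (use 3 zero jB in auto)
      then show ?thesis using 3 by simp
    next
      case 4
      then have "mset (word i) \<noteq> mset (word j)" using inj i j by (auto simp: inj_on_def)
      then have "?\<phi> (word i) = 0"
        using shuffle_list_leading[OF zero dual jB words[OF i] 4(1)] by auto
      then show ?thesis using 4 by simp
    qed simp
  qed
  also have "\<dots> = a j * ?\<phi> (word j)" using S j by simp
  finally show False
    using shuffle_list_leading[OF zero dual jB jB refl] j by auto
qed

section \<open>Diagonalizable elements\<close>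

text \<open>
  The commutator with \<open>h\<close> is a derivation, so eigenvalues add up along a word.
\<close>

lemma diagonal_action_on_word:
  assumes "\<And>b. b \<in> set w \<Longrightarrow> lie_bracket h b = lie_scale (\<gamma> b) b"
  shows "uea_incl h * word_value w - word_value w * uea_incl h
    = uea_scale (sum_list (map \<gamma> w)) (word_value w)"
  using assms
proof (induction w)
  case (Cons b w)
  have 1: "uea_incl h * uea_incl b - uea_incl b * uea_incl h = uea_scale (\<gamma> b) (uea_incl b)"
    using Cons.prems[of b] by (simp add: uea_incl_bracket uea_incl_scale)
  have 2: "uea_incl h * word_value w - word_value w * uea_incl h
    = uea_scale (sum_list (map \<gamma> w)) (word_value w)"
    using Cons by auto
  have "uea_incl h * word_value (b # w) - word_value (b # w) * uea_incl h
      = (uea_incl h * uea_incl b - uea_incl b * uea_incl h) * word_value w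
        + uea_incl b * (uea_incl h * word_value w - word_value w * uea_incl h)"
    by (simp add: algebra_simps)
  then show ?case
    by (simp only: 1 2) (simp add: uea_scale_mult_left uea_scale_mult_right uea.scale_left_distrib)
qed simp

text \<open>
  Subtracting \<open>\<nu>\<close> times the sum from its commutator with \<open>h\<close> removes the component at \<open>\<nu>\<close> and
  multiplies the others by nonzero numbers.
\<close>

lemma eigenvectors_sum_zero:
  fixes s :: "complex \<Rightarrow> 'a::complex_lie_algebra uea"
  assumes "finite M" and "\<And>\<mu>. \<mu> \<in> M \<Longrightarrow> h * s \<mu> - s \<mu> * h = uea_scale \<mu> (s \<mu>)"
    and "sum s M = 0" and "\<mu> \<in> M"
  shows "s \<mu> = 0"
  using assms
proof (induction M arbitrary: s \<mu> rule: finite_induct)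
  case (insert \<nu> M)
  have scaled: "(\<Sum>\<mu>\<in>insert \<nu> M. uea_scale \<mu> (s \<mu>)) = 0"
  proof -
    have "(\<Sum>\<mu>\<in>insert \<nu> M. uea_scale \<mu> (s \<mu>)) = h * sum s (insert \<nu> M) - sum s (insert \<nu> M) * h"
      using insert.prems(1)
      by (simp add: sum_distrib_left sum_distrib_right sum_subtractf[symmetric] insert.hyps algebra_simps
          del: sum.insert)
    then show ?thesis using insert.prems(2) by simp
  qed
  have "(\<Sum>\<mu>\<in>insert \<nu> M. uea_scale (\<mu> - \<nu>) (s \<mu>))
      = (\<Sum>\<mu>\<in>insert \<nu> M. uea_scale \<mu> (s \<mu>)) - uea_scale \<nu> (sum s (insert \<nu> M))"
    by (simp add: uea.scale_sum_right sum_subtractf uea.scale_left_diff_distrib del: sum.insert)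
  then have "(\<Sum>\<mu>\<in>M. uea_scale (\<mu> - \<nu>) (s \<mu>)) = 0"
    using insert.hyps insert.prems(2) scaled by simp
  then have "uea_scale (\<mu> - \<nu>) (s \<mu>) = 0" if "\<mu> \<in> M" for \<mu>
  proof (rule insert.IH[rotated])
    fix \<mu> assume "\<mu> \<in> M"
    then have "h * s \<mu> - s \<mu> * h = uea_scale \<mu> (s \<mu>)" using insert.prems(1) by simp
    from arg_cong[OF this, of "uea_scale (\<mu> - \<nu>)"]
    show "h * uea_scale (\<mu> - \<nu>) (s \<mu>) - uea_scale (\<mu> - \<nu>) (s \<mu>) * h
        = uea_scale \<mu> (uea_scale (\<mu> - \<nu>) (s \<mu>))"
      by (simp add: uea_scale_mult_left uea_scale_mult_right uea.scale_right_diff_distrib mult.commute)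
  qed (use that in auto)
  then have zero: "s \<mu> = 0" if "\<mu> \<in> M" for \<mu> using that insert.hyps by auto
  moreover have "s \<nu> = 0" using insert.prems(2) insert.hyps zero by simp
  ultimately show ?case using insert.prems(3) by auto
qed simp


section \<open>A dual system for the basis of the Lie algebra of type $C_2$\<close>

definition c2_letters :: "c2 set" where
  "c2_letters = {e10, f10, e01, f01, h10, h01, e11, e21, f11, f21}"

lemmas c2_matrix_letters = e10.rep_eq f10.rep_eq e01.rep_eq f01.rep_eq h10.rep_eq h01.rep_eq
  e11.rep_eq e21.rep_eq f11.rep_eq f21.rep_eq

lemma distinct_c2_letters: "distinct [e10, f10, e01, f01, h10, h01, e11, e21, f11, f21]"
proof -
  \<comment> \<open>A linear form that takes ten different values on the basis.\<close>
  define tag where "tag x = (let A = c2_matrix x in A$1$2 + 2 * A$2$1 + 3 * A$3$1 + 4 * A$1$3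
    - 5 * A$2$2 + 6 * (- A$1$1 - A$2$2) - 7 * A$4$1 + 4 * A$4$2 - 9 * A$2$3 + 5 * A$2$4)" for x
  have "map tag [e10, f10, e01, f01, h10, h01, e11, e21, f11, f21] = [1, 2, 3, 4, 5, 6, 7, 8, 9, 10]"
    by (simp add: tag_def c2_matrix_letters m_defs mat_unit_nth cmat_scale_def)
  then have "distinct (map tag [e10, f10, e01, f01, h10, h01, e11, e21, f11, f21])"
    by (simp only:) simp
  then show ?thesis by (rule distinct_map[THEN iffD1, THEN conjunct1])
qed

lemmas c2_letters_distinct [simp] =
  distinct_c2_letters[simplified]
  distinct_rev[THEN iffD2, OF distinct_c2_letters, simplified]

text \<open>
  The coordinates are linear forms in the matrix entries.  They are defined for arbitrary matrices
  because they are going to be applied to products, which lie outside the Lie algebra.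
\<close>

definition coordinate :: "c2 \<Rightarrow> complex^4^4 \<Rightarrow> complex" where
  "coordinate b A =
    (if b = e10 then A$1$2 else if b = f10 then A$2$1 else if b = e01 then A$3$1
     else if b = f01 then A$1$3 else if b = h10 then - A$2$2 else if b = h01 then - A$1$1 - A$2$2
     else if b = e11 then - A$4$1 else if b = e21 then A$4$2 / 2
     else if b = f11 then - A$2$3 else A$2$4 / 2)"


lemma coordinate_simps:
  "coordinate e10 A = A$1$2" "coordinate f10 A = A$2$1" "coordinate e01 A = A$3$1"
  "coordinate f01 A = A$1$3" "coordinate h10 A = - A$2$2" "coordinate h01 A = - A$1$1 - A$2$2"
  "coordinate e11 A = - A$4$1" "coordinate e21 A = A$4$2 / 2"
  "coordinate f11 A = - A$2$3" "coordinate f21 A = A$2$4 / 2"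
  by (simp_all add: coordinate_def)

lemma coordinate_linear:
  "coordinate b (A + B) = coordinate b A + coordinate b B"
  "coordinate b (A - B) = coordinate b A - coordinate b B"
  "coordinate b (cmat_scale c A) = c * coordinate b A"
  by (simp_all add: coordinate_def cmat_scale_def algebra_simps diff_divide_distrib add_divide_distrib)

lemma coordinate_letters:
  "b \<in> c2_letters \<Longrightarrow> b' \<in> c2_letters \<Longrightarrow> coordinate b (c2_matrix b') = (if b' = b then 1 else 0)"
  unfolding c2_letters_def
  by (elim insertE emptyE; hypsubst)
    (simp_all add: coordinate_simps c2_matrix_letters m_defs mat_unit_nth cmat_scale_def)

lemma finite_c2_letters [simp]: "finite c2_letters"
  by (simp add: c2_letters_def)

lemma c2_expansion: "x = (\<Sum>b\<in>c2_letters. lie_scale (coordinate b (c2_matrix x)) b)"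
proof -
  have "c2_matrix x \<in> cmat.span c2_basis" by (rule c2_matrix)
  then have "c2_matrix x = c2_matrix (\<Sum>b\<in>c2_letters. lie_scale (coordinate b (c2_matrix x)) b)"
    unfolding c2_span_iff c2_letters_def
    by (simp add: coordinate_simps vec_eq_iff forall_4 plus_c2.rep_eq
        minus_c2.rep_eq uminus_c2.rep_eq lie_scale_c2.rep_eq
        c2_matrix_letters m_defs mat_unit_nth cmat_scale_def)
  then show ?thesis by (simp add: c2_matrix_inject)
qed

definition matrix_word :: "c2 list \<Rightarrow> complex^4^4" where
  "matrix_word w = foldr (\<lambda>x A. c2_matrix x ** A) w (mat 1)"

lemma cmat_scale_mult:
  "cmat_scale c A ** B = cmat_scale c (A ** B)" "A ** cmat_scale c B = cmat_scale c (A ** B)"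
  for A B :: "complex^'n^'n"
  by (simp_all add: cmat_scale_def matrix_matrix_mult_def vec_eq_iff sum_distrib_left algebra_simps)

lemma matrix_add_rdistrib: "(A + B) ** C = A ** C + B ** C" for A B C :: "complex^'n^'n"
  by (simp add: matrix_matrix_mult_def vec_eq_iff sum.distrib algebra_simps)

lemma matrix_word_append: "matrix_word (u @ v) = matrix_word u ** matrix_word v"
  by (induction u) (simp_all add: matrix_word_def matrix_mul_assoc)

lemma matrix_word_Cons: "matrix_word (x # v) = c2_matrix x ** matrix_word v"
  by (simp add: matrix_word_def)

text \<open>
  A coordinate of the product of the matrices in a word is a functional on the enveloping algebra.
  Its value on the empty word is changed to 0, to make it vanish to first order; the relations of
  the enveloping algebra have no constant term and are therefore still respected.
\<close>

definition dual_functional :: "c2 \<Rightarrow> c2 list \<Rightarrow> complex" where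
  "dual_functional b w = (if w = [] then 0 else coordinate b (matrix_word w))"

lemma lie_functional_dual_functional: "lie_functional (dual_functional b)"
proof -
  have "matrix_word (u @ (x + y) # v) = matrix_word (u @ x # v) + matrix_word (u @ y # v)"
    "matrix_word (u @ lie_scale c x # v) = cmat_scale c (matrix_word (u @ x # v))"
    "matrix_word (u @ lie_bracket x y # v) = matrix_word (u @ x # y # v) - matrix_word (u @ y # x # v)"
    for u v x y c
    by (simp_all add: matrix_word_append matrix_word_Cons plus_c2.rep_eq lie_scale_c2.rep_eq
        lie_bracket_c2.rep_eq commutator_def cmat_scale_mult matrix_add_ldistrib matrix_add_rdistrib
        matrix_diff_ldistrib matrix_diff_rdistrib matrix_mul_assoc)
  then show ?thesis
    by (simp add: lie_functional_def dual_functional_def coordinate_linear)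
qed

theorem c2_word_values_independent:
  assumes "finite S" and "\<And>i. i \<in> S \<Longrightarrow> set (word i) \<subseteq> c2_letters"
    and "inj_on (\<lambda>i. mset (word i)) S"
    and "(\<Sum>i\<in>S. uea_scale (a i) (word_value (word i))) = 0" and "i \<in> S"
  shows "a i = 0"
proof (rule word_values_independent[where B = c2_letters and d = dual_functional and S = S])
  show "dual_functional b [b'] = (if b' = b then 1 else 0)"
    if "b \<in> c2_letters" "b' \<in> c2_letters" for b b'
    using coordinate_letters[OF that] by (simp add: dual_functional_def matrix_word_def)
qed (use assms in \<open>auto simp: lie_functional_dual_functional dual_functional_def\<close>)


section \<open>Weights\<close>

text \<open>
  A root is recorded as a Gaussian integer: the simple roots of \<^const>\<open>e10\<close> and \<^const>\<open>e01\<close> become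
  \<open>1\<close> and \<open>\<i>\<close>.  Thus a weight is a single number, whose vanishing amounts to two conditions on
  integers.
\<close>

definition weight :: "c2 \<Rightarrow> complex" where
  "weight b =
    (if b = e10 then 1 else if b = f10 then -1 else if b = e01 then \<i> else if b = f01 then -\<i>
     else if b = e11 then 1 + \<i> else if b = f11 then -1 - \<i>
     else if b = e21 then 2 + \<i> else if b = f21 then -2 - \<i> else 0)"

lemma weight_simps:
  "weight e10 = 1" "weight f10 = -1" "weight e01 = \<i>" "weight f01 = -\<i>" "weight e11 = 1 + \<i>"
  "weight f11 = -1 - \<i>" "weight e21 = 2 + \<i>" "weight f21 = -2 - \<i>"
  "weight h10 = 0" "weight h01 = 0"
  by (simp_all add: weight_def)

definition word_weight :: "c2 list \<Rightarrow> complex" where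
  "word_weight w = sum_list (map weight w)"

lemma word_weight_simps [simp]:
  "word_weight [] = 0" "word_weight (x # w) = weight x + word_weight w"
  "word_weight (v @ w) = word_weight v + word_weight w"
  by (simp_all add: word_weight_def)

lemma cartan_action:
  assumes "b \<in> c2_letters"
  shows "lie_bracket h10 b = lie_scale (of_real (2 * Re (weight b) - 2 * Im (weight b))) b"
    and "lie_bracket h01 b = lie_scale (of_real (2 * Im (weight b) - Re (weight b))) b"
  using assms unfolding c2_letters_def
  by (elim insertE emptyE; hypsubst; intro c2_matrix_inject[THEN iffD1]; simp add: weight_simps
      lie_bracket_c2.rep_eq lie_scale_c2.rep_eq uminus_c2.rep_eq zero_c2.rep_eq c2_matrix_letters commutator_def
      matrix_matrix_mult_def sum_4 vec_eq_iff forall_4 m_defs mat_unit_nth cmat_scale_def)+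

text \<open>
  The coefficients are chosen such that the simple roots take the values \<open>1\<close> and \<open>\<i>\<close> at this
  element, which then acts on every basis vector by its \<^const>\<open>weight\<close>.
\<close>

definition grading_element :: c2 where
  "grading_element = lie_scale (1 + \<i> / 2) h10 + lie_scale (1 + \<i>) h01"

lemma grading_element_in_cartan: "grading_element \<in> cartan"
  unfolding grading_element_def cartan_def
  by (intro lie.span_add lie.span_scale lie.span_base) auto

lemma coordinate_grading_bracket:
  assumes "b \<in> c2_letters"
  shows "coordinate b (c2_matrix (lie_bracket grading_element x)) = weight b * coordinate b (c2_matrix x)"
proof -
  have "c2_matrix x \<in> cmat.span c2_basis" by (rule c2_matrix)
  with assms show ?thesis
    unfolding c2_letters_def c2_span_iff
    by (elim insertE emptyE; hypsubst; simp add: coordinate_simps weight_simps grading_element_def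
      lie_bracket_c2.rep_eq lie_scale_c2.rep_eq plus_c2.rep_eq c2_matrix_letters commutator_def
      matrix_matrix_mult_def sum_4 m_defs mat_unit_nth cmat_scale_def algebra_simps
      diff_divide_distrib add_divide_distrib)
qed

lemma grading_element_action:
  assumes "b \<in> c2_letters"
  shows "lie_bracket grading_element b = lie_scale (weight b) b"
proof -
  have "lie_bracket grading_element b
      = (\<Sum>b'\<in>c2_letters. lie_scale (coordinate b' (c2_matrix (lie_bracket grading_element b))) b')"
    by (rule c2_expansion)
  also have "\<dots> = (\<Sum>b'\<in>c2_letters. if b' = b then lie_scale (weight b) b else 0)"
    by (intro sum.cong refl) (auto simp: coordinate_grading_bracket coordinate_letters assms)
  also have "\<dots> = lie_scale (weight b) b" using assms by simp
  finally show ?thesis .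
qed

text \<open>
  By the Jacobi identity the bracket is an eigenvector of the grading element, so that its
  coordinates at other weights vanish.  This replaces the table of brackets of basis vectors.
\<close>

lemma coordinate_bracket:
  assumes "x \<in> c2_letters" "y \<in> c2_letters" "b \<in> c2_letters" "weight b \<noteq> weight x + weight y"
  shows "coordinate b (c2_matrix (lie_bracket x y)) = 0"
proof -
  have "lie_bracket grading_element (lie_bracket x y) = lie_scale (weight x + weight y) (lie_bracket x y)"
  proof -
    have neg: "lie_bracket u v = - lie_bracket v u" for u v :: c2
      by (rule c2_matrix_inject[THEN iffD1])
        (simp add: lie_bracket_c2.rep_eq uminus_c2.rep_eq commutator_def)
    have "lie_bracket grading_element (lie_bracket x y)
        = lie_bracket x (lie_bracket grading_element y) - lie_bracket y (lie_bracket grading_element x)"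
      by (rule c2_matrix_inject[THEN iffD1])
        (simp add: minus_c2.rep_eq lie_bracket_c2.rep_eq commutator_def
          matrix_diff_ldistrib matrix_diff_rdistrib matrix_mul_assoc)
    also have "\<dots> = lie_scale (weight y) (lie_bracket x y) - lie_scale (weight x) (lie_bracket y x)"
      by (simp add: grading_element_action assms lie_bracket_scale_right)
    also have "\<dots> = lie_scale (weight x + weight y) (lie_bracket x y)"
      by (subst neg[of y x]) (simp add: lie.scale_left_distrib)
    finally show ?thesis .
  qed
  then have "weight b * coordinate b (c2_matrix (lie_bracket x y))
    = (weight x + weight y) * coordinate b (c2_matrix (lie_bracket x y))"
    by (simp add: coordinate_linear lie_scale_c2.rep_eq flip: coordinate_grading_bracket[OF assms(3)])
  then show ?thesis using assms(4) by simp
qed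

section \<open>Reordering words\<close>

text \<open>
  Think of \<open>L M\<close> as the errors that are negligible for products of the factors in \<open>M\<close>.  If
  exchanging two adjacent factors costs a negligible error, then so does any permutation.  This
  applies to the enveloping algebra and, modulo the relations of length two, to the free algebra.
\<close>

lemma permuted_products:
  fixes f :: "'b \<Rightarrow> 'a::ring_1" and L :: "'b multiset \<Rightarrow> 'a set"
  assumes zero: "\<And>M. 0 \<in> L M"
    and add: "\<And>M s t. s \<in> L M \<Longrightarrow> t \<in> L M \<Longrightarrow> s + t \<in> L M"
    and mult: "\<And>x M s. x \<in> A \<Longrightarrow> s \<in> L M \<Longrightarrow> f x * s \<in> L (add_mset x M)"
    and swap: "\<And>x y v. x \<in> A \<Longrightarrow> y \<in> A \<Longrightarrow> set v \<subseteq> A \<Longrightarrow>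
      f x * f y * prod_list (map f v) - f y * f x * prod_list (map f v) \<in> L (mset (x # y # v))"
    and "mset w = mset w'" and "set w \<subseteq> A"
  shows "prod_list (map f w) - prod_list (map f w') \<in> L (mset w)"
proof -
  let ?\<pi> = "\<lambda>w. prod_list (map f w)"
  have move: "?\<pi> (x # p @ q) - ?\<pi> (p @ x # q) \<in> L (mset (x # p @ q))"
    if "x \<in> A" "set p \<subseteq> A" "set q \<subseteq> A" for x p q
    using that(2)
  proof (induction p)
    case Nil
    show ?case by (simp add: zero)
  next
    case (Cons a p)
    have "f x * f a * ?\<pi> (p @ q) - f a * f x * ?\<pi> (p @ q) \<in> L (mset (x # a # p @ q))"
      by (rule swap) (use that Cons.prems in auto)
    moreover have "f a * (?\<pi> (x # p @ q) - ?\<pi> (p @ x # q)) \<in> L (mset (x # a # p @ q))"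
      using mult[of a "?\<pi> (x # p @ q) - ?\<pi> (p @ x # q)" "mset (x # p @ q)"] Cons
      by (simp add: add_mset_commute)
    ultimately have "(f x * f a * ?\<pi> (p @ q) - f a * f x * ?\<pi> (p @ q))
        + f a * (?\<pi> (x # p @ q) - ?\<pi> (p @ x # q)) \<in> L (mset (x # a # p @ q))"
      by (rule add)
    then show ?case by (simp add: algebra_simps)
  qed
  show ?thesis
    using assms(5,6)
  proof (induction w arbitrary: w')
    case Nil
    then show ?case by (simp add: zero)
  next
    case (Cons x v)
    from Cons.prems(1) have "x \<in> set w'" using mset_eq_setD by fastforce
    then obtain p q where w': "w' = p @ x # q" by (auto simp: in_set_conv_decomp)
    have vpq: "mset v = mset (p @ q)" using Cons.prems(1) w' by simp
    have set: "set p \<union> set q = set v" using mset_eq_setD[OF vpq] by simp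
    have "f x * (?\<pi> v - ?\<pi> (p @ q)) \<in> L (mset (x # v))"
      using mult[of x _ "mset v"] Cons.IH[OF vpq] Cons.prems(2) by simp
    moreover have "?\<pi> (x # p @ q) - ?\<pi> (p @ x # q) \<in> L (mset (x # v))"
      using move[of x p q] Cons.prems(2) set vpq by auto
    ultimately have "f x * (?\<pi> v - ?\<pi> (p @ q)) + (?\<pi> (x # p @ q) - ?\<pi> (p @ x # q)) \<in> L (mset (x # v))"
      by (rule add)
    then show ?case by (simp add: w' algebra_simps)
  qed
qed

definition words_below :: "nat \<Rightarrow> complex \<Rightarrow> c2 list set" where
  "words_below k \<mu> = {w. set w \<subseteq> c2_letters \<and> length w < k \<and> word_weight w = \<mu>}"

definition values_below :: "nat \<Rightarrow> complex \<Rightarrow> c2 uea set" where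
  "values_below k \<mu> = uea.span (word_value ` words_below k \<mu>)"

lemma word_value_below:
  "set w \<subseteq> c2_letters \<Longrightarrow> length w < k \<Longrightarrow> word_value w \<in> values_below k (word_weight w)"
  unfolding values_below_def by (rule uea.span_base) (auto simp: words_below_def)

lemma values_below_mult_left:
  assumes "x \<in> c2_letters" and "s \<in> values_below k \<mu>"
  shows "uea_incl x * s \<in> values_below (Suc k) (weight x + \<mu>)"
  using assms(2) unfolding values_below_def
proof (induction s rule: uea.span_induct_alt)
  case (step c s u)
  from step(1) obtain w where w: "s = word_value w" "w \<in> words_below k \<mu>" by auto
  have "uea_incl x * s \<in> uea.span (word_value ` words_below (Suc k) (weight x + \<mu>))"
    by (rule uea.span_base) (use assms(1) w in \<open>auto simp: words_below_def intro!: image_eqI[of _ _ "x # w"]\<close>)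
  then show ?case using step(2)
    by (simp add: distrib_left uea_scale_mult_right uea.span_add uea.span_scale)
qed (simp add: uea.span_zero)

text \<open>
  The bracket of two letters is a combination of single letters whose weight is the sum of their
  weights.
\<close>

lemma swap_adjacent_letters:
  assumes "x \<in> c2_letters" "y \<in> c2_letters" "set v \<subseteq> c2_letters"
  shows "word_value (x # y # v) - word_value (y # x # v)
    \<in> values_below (length (x # y # v)) (word_weight (x # y # v))"
proof -
  let ?c = "\<lambda>b. coordinate b (c2_matrix (lie_bracket x y))"
  have "word_value (x # y # v) - word_value (y # x # v) = uea_incl (lie_bracket x y) * word_value v"
    by (simp add: algebra_simps flip: uea_incl_bracket)
  also have "\<dots> = (\<Sum>b\<in>c2_letters. uea_scale (?c b) (word_value (b # v)))"
    by (subst c2_expansion[of "lie_bracket x y"], subst uea_incl_sum)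
      (simp add: sum_distrib_right uea_scale_mult_left)
  also have "\<dots> \<in> values_below (length (x # y # v)) (word_weight (x # y # v))"
    unfolding values_below_def
  proof (intro uea.span_sum)
    fix b assume b: "b \<in> c2_letters"
    show "uea_scale (?c b) (word_value (b # v))
        \<in> uea.span (word_value ` words_below (length (x # y # v)) (word_weight (x # y # v)))"
    proof (cases "weight b = weight x + weight y")
      case True
      then show ?thesis
        by (intro uea.span_scale uea.span_base imageI)
          (use b assms(3) in \<open>auto simp: words_below_def algebra_simps\<close>)
    next
      case False
      then show ?thesis using coordinate_bracket[OF assms(1,2) b] by (simp add: uea.span_zero)
    qed
  qed
  finally show ?thesis .
qed

lemma permuted_words:
  assumes "mset w = mset w'" and "set w \<subseteq> c2_letters"
  shows "word_value w - word_value w' \<in> values_below (length w) (word_weight w)"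
proof -
  let ?L = "\<lambda>M. values_below (size M) (\<Sum>b\<in>#M. weight b)"
  have mset: "?L (mset v) = values_below (length v) (word_weight v)" for v
    by (simp add: word_weight_def flip: sum_mset_sum_list)
  have "prod_list (map uea_incl w) - prod_list (map uea_incl w') \<in> ?L (mset w)"
  proof (rule permuted_products[where A = c2_letters and L = ?L])
    fix x y v assume "x \<in> c2_letters" "y \<in> c2_letters" "set v \<subseteq> c2_letters"
    from swap_adjacent_letters[OF this]
    show "uea_incl x * uea_incl y * prod_list (map uea_incl v)
        - uea_incl y * uea_incl x * prod_list (map uea_incl v) \<in> ?L (mset (x # y # v))"
      unfolding mset by (simp add: mult.assoc flip: word_value_def)
  qed (use assms values_below_mult_left in
      \<open>auto simp: values_below_def uea.span_zero uea.span_add\<close>)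
  then show ?thesis unfolding mset word_value_def .
qed

section \<open>The centralizer as the zero weight part\<close>

lemma span_letter_words: "u \<in> uea.span (word_value ` {w. set w \<subseteq> c2_letters})" (is "u \<in> ?S")
proof -
  have mult: "uea_incl b * s \<in> ?S" if "b \<in> c2_letters" "s \<in> ?S" for b s
    using that(2)
  proof (induction s rule: uea.span_induct_alt)
    case (step c s u)
    from step(1) obtain w where w: "s = word_value w" "set w \<subseteq> c2_letters" by auto
    have "uea_incl b * s \<in> ?S"
      by (rule uea.span_base) (use that(1) w in \<open>auto intro!: image_eqI[of _ _ "b # w"]\<close>)
    then show ?case using step(2)
      by (simp add: distrib_left uea_scale_mult_right uea.span_add uea.span_scale)
  qed (simp add: uea.span_zero)
  have word: "word_value w \<in> ?S" for w
  proof (induction w)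
    case Nil
    show ?case by (rule uea.span_base) (auto intro!: image_eqI[of _ _ "[]"])
  next
    case (Cons x w)
    let ?c = "\<lambda>b. coordinate b (c2_matrix x)"
    have "word_value (x # w) = (\<Sum>b\<in>c2_letters. uea_scale (?c b) (uea_incl b * word_value w))"
      unfolding word_value_simps
      by (subst c2_expansion[of x], subst uea_incl_sum) (simp add: sum_distrib_right uea_scale_mult_left)
    also have "\<dots> \<in> ?S" by (intro uea.span_sum uea.span_scale mult Cons)
    finally show ?case .
  qed
  have "uea.span (range word_value) \<subseteq> ?S"
    by (rule uea.span_minimal) (use word in auto)
  then show ?thesis using uea_in_span_words by blast
qed

lemma weight_decomposition:
  assumes "u \<in> uea.span (word_value ` W)"
  shows "\<exists>M s. finite M \<and> (\<forall>\<mu>\<in>M. s \<mu> \<in> uea.span (word_value ` {w \<in> W. word_weight w = \<mu>})) \<and> u = sum s M"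
  using assms
proof (induction u rule: uea.span_induct_alt)
  case base
  show ?case by (intro exI[of _ "{}"]) simp
next
  case (step c x y)
  from step(1) obtain w where w: "x = word_value w" "w \<in> W" by auto
  from step(2) obtain M s where M: "finite M" and
    s: "\<And>\<mu>. \<mu> \<in> M \<Longrightarrow> s \<mu> \<in> uea.span (word_value ` {w \<in> W. word_weight w = \<mu>})" and y: "y = sum s M"
    by blast
  define s' where "s' \<mu> = (if \<mu> \<in> M then s \<mu> else 0) + (if \<mu> = word_weight w then uea_scale c x else 0)" for \<mu>
  have "uea_scale c x \<in> uea.span (word_value ` {w' \<in> W. word_weight w' = word_weight w})"
    by (intro uea.span_scale uea.span_base) (use w in auto)
  then have "s' \<mu> \<in> uea.span (word_value ` {w \<in> W. word_weight w = \<mu>})" for \<mu>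
    unfolding s'_def by (intro uea.span_add) (auto simp: uea.span_zero s)
  moreover have "uea_scale c x + y = sum s' (insert (word_weight w) M)"
  proof -
    have "(\<Sum>\<mu>\<in>insert (word_weight w) M. if \<mu> \<in> M then s \<mu> else 0) = sum s M"
      by (rule sum.mono_neutral_cong_right) (use M in auto)
    then show ?thesis
      unfolding s'_def sum.distrib using M y by (simp add: add.commute del: sum.insert)
  qed
  ultimately show ?case using M by (intro exI[of _ "insert (word_weight w) M"] exI[of _ s']) auto
qed

lemma grading_action_on_span:
  assumes "u \<in> uea.span (word_value ` {w \<in> W. word_weight w = \<mu>})" and "\<And>w. w \<in> W \<Longrightarrow> set w \<subseteq> c2_letters"
  shows "uea_incl grading_element * u - u * uea_incl grading_element = uea_scale \<mu> u"
  using assms(1)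
proof (induction u rule: uea.span_induct_alt)
  case (step c x y)
  from step(1) obtain w where w: "x = word_value w" "w \<in> W" "word_weight w = \<mu>" by auto
  have "uea_incl grading_element * x - x * uea_incl grading_element = uea_scale \<mu> x"
    unfolding w(1) w(3)[symmetric] word_weight_def
    by (rule diagonal_action_on_word) (use assms(2) w(2) grading_element_action in blast)
  from arg_cong[OF this, of "uea_scale c"] step(2) show ?case
    by (simp add: algebra_simps uea_scale_mult_left uea_scale_mult_right uea.scale_right_distrib
        uea.scale_right_diff_distrib)
qed simp

text \<open>
  Elements of the centralizer commute with the grading element.  Their weight components are
  eigenvectors for distinct eigenvalues, hence vanish for every nonzero weight.
\<close>

lemma U0_zero_weight_part:
  assumes "u \<in> U0" and "u \<in> uea.span (word_value ` W)" and W: "\<And>w. w \<in> W \<Longrightarrow> set w \<subseteq> c2_letters"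
  shows "u \<in> uea.span (word_value ` {w \<in> W. word_weight w = 0})"
proof -
  let ?h = "uea_incl grading_element"
  obtain M s where M: "finite M" and
    s: "\<And>\<mu>. \<mu> \<in> M \<Longrightarrow> s \<mu> \<in> uea.span (word_value ` {w \<in> W. word_weight w = \<mu>})" and u: "u = sum s M"
    using weight_decomposition[OF assms(2)] by blast
  have eig: "?h * s \<mu> - s \<mu> * ?h = uea_scale \<mu> (s \<mu>)" if "\<mu> \<in> M" for \<mu>
    using grading_action_on_span[OF s[OF that] W] .
  have "?h * u = u * ?h" using assms(1) grading_element_in_cartan by (simp add: U0_def)
  then have "(\<Sum>\<mu>\<in>M. ?h * s \<mu> - s \<mu> * ?h) = 0"
    by (simp add: u sum_distrib_left sum_distrib_right sum_subtractf)
  then have sum0: "(\<Sum>\<mu>\<in>M. uea_scale \<mu> (s \<mu>)) = 0" using eig by simp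
  have "uea_scale \<mu> (s \<mu>) = 0" if "\<mu> \<in> M" for \<mu>
  proof (rule eigenvectors_sum_zero[OF M _ sum0 that])
    fix \<nu> assume "\<nu> \<in> M"
    from arg_cong[OF eig[OF this], of "uea_scale \<nu>"]
    show "?h * uea_scale \<nu> (s \<nu>) - uea_scale \<nu> (s \<nu>) * ?h = uea_scale \<nu> (uea_scale \<nu> (s \<nu>))"
      by (simp add: uea_scale_mult_left uea_scale_mult_right uea.scale_right_diff_distrib)
  qed
  then have "s \<mu> = 0" if "\<mu> \<in> M" "\<mu> \<noteq> 0" for \<mu> using that by auto
  then have "u = (\<Sum>\<mu>\<in>M. if \<mu> = 0 then s 0 else 0)" unfolding u by (intro sum.cong) auto
  then have "u = (if 0 \<in> M then s 0 else 0)" using M by simp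
  then show ?thesis using s[of 0] by (auto simp: uea.span_zero)
qed

text \<open>
  On a word, both generators of the Cartan subalgebra act by real linear combinations of the real
  and the imaginary part of its weight.
\<close>

lemma zero_weight_word_in_U0:
  assumes "set w \<subseteq> c2_letters" and "word_weight w = 0"
  shows "word_value w \<in> U0"
proof -
  let ?C = "{h. uea_incl h * word_value w = word_value w * uea_incl h}"
  have sums: "(\<Sum>b\<leftarrow>w. Re (weight b)) = 0" "(\<Sum>b\<leftarrow>w. Im (weight b)) = 0"
  proof -
    have "(\<Sum>b\<leftarrow>w. Re (weight b)) = Re (word_weight w)" "(\<Sum>b\<leftarrow>w. Im (weight b)) = Im (word_weight w)"
      by (induction w) (simp_all add: word_weight_def)
    then show "(\<Sum>b\<leftarrow>w. Re (weight b)) = 0" "(\<Sum>b\<leftarrow>w. Im (weight b)) = 0" using assms(2) by simp_all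
  qed
  have lin: "(\<Sum>b\<leftarrow>w. of_real (c * Re (weight b) + d * Im (weight b))) = (0 :: complex)" for c d
  proof -
    have "(\<Sum>b\<leftarrow>w. of_real (c * Re (weight b) + d * Im (weight b)))
      = (of_real (c * (\<Sum>b\<leftarrow>w. Re (weight b)) + d * (\<Sum>b\<leftarrow>w. Im (weight b))) :: complex)"
      by (induction w) (simp_all add: algebra_simps)
    then show ?thesis by (simp add: sums)
  qed
  have h10: "h10 \<in> ?C"
    using diagonal_action_on_word[of w h10 "\<lambda>b. of_real (2 * Re (weight b) - 2 * Im (weight b))"]
      cartan_action(1) assms(1) lin[of 2 "-2"] by auto
  have h01: "h01 \<in> ?C"
    using diagonal_action_on_word[of w h01 "\<lambda>b. of_real (2 * Im (weight b) - Re (weight b))"]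
      cartan_action(2) assms(1) lin[of "-1" 2] by auto
  have "h \<in> ?C" if "h \<in> cartan" for h
    using that unfolding cartan_def
  proof (induction h rule: lie.span_induct_alt)
    case (step c x y)
    then show ?case using h10 h01
      by (auto simp: uea_incl_add uea_incl_scale uea_scale_mult_left uea_scale_mult_right algebra_simps)
  qed (simp add: uea_incl_zero)
  then show ?thesis by (simp add: U0_def)
qed

lemma U0_subspace: "uea.subspace U0"
  unfolding uea.subspace_def U0_def
  by (auto simp: algebra_simps uea_scale_mult_left uea_scale_mult_right)

section \<open>Semi-perfect words\<close>

lemma omega_simps [simp]:
  "omega [] = []" "omega (l # Y) = letter_word l @ omega Y" "omega (Y @ Z) = omega Y @ omega Z"
  by (simp_all add: omega_def)

lemma letter_word_not_Nil [simp]: "letter_word l \<noteq> []"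
proof (cases l)
  case (CL c)
  then show ?thesis by (cases c) auto
qed simp

lemma letter_word_letters: "set (letter_word l) \<subseteq> c2_letters"
proof (cases l)
  case (HL h)
  then show ?thesis by (cases h) (auto simp: c2_letters_def)
next
  case (CL c)
  then show ?thesis by (cases c) (auto simp: c2_letters_def)
qed

lemma omega_letters: "set (omega Y) \<subseteq> c2_letters"
  by (induction Y) (use letter_word_letters in auto)

lemma omega_weight: "word_weight (omega Y) = 0"
proof (induction Y)
  case (Cons l Y)
  have "word_weight (letter_word l) = 0"
  proof (cases l)
    case (HL h)
    then show ?thesis by (cases h) (simp_all add: weight_simps)
  next
    case (CL c)
    then show ?thesis by (cases c) (simp_all add: weight_simps)
  qed
  with Cons show ?case by simp
qed simp

fun letter_index :: "letter \<Rightarrow> nat" where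
  "letter_index (HL h) = h_index h"
| "letter_index (CL c) = 2 + c_index c"

lemma c_index_bounds: "1 \<le> c_index c" "c_index c \<le> 12"
  by (cases c; simp)+

lemma h_index_bounds: "1 \<le> h_index h" "h_index h \<le> 2"
  by (cases h; simp)+

lemma letter_less_iff: "letter_less a b \<longleftrightarrow> letter_index a < letter_index b"
proof (cases a; cases b)
  fix h c assume "a = HL h" "b = CL c"
  then show ?thesis using h_index_bounds(2)[of h] c_index_bounds(1)[of c] by simp
next
  fix h c assume "a = CL c" "b = HL h"
  then show ?thesis using h_index_bounds(2)[of h] c_index_bounds(1)[of c] by simp
qed simp_all

lemma letter_index_inj: "letter_index a = letter_index b \<Longrightarrow> a = b"
proof (cases a; cases b)
  fix h h' assume "letter_index a = letter_index b" "a = HL h" "b = HL h'"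
  then show "a = b" by (cases h; cases h') auto
next
  fix c c' assume "letter_index a = letter_index b" "a = CL c" "b = CL c'"
  then show "a = b" by (cases c; cases c') auto
next
  fix h c assume "letter_index a = letter_index b" "a = HL h" "b = CL c"
  then show "a = b" by (cases h; cases c) auto
next
  fix h c assume "letter_index a = letter_index b" "a = CL c" "b = HL h"
  then show "a = b" by (cases h; cases c) auto
qed

text \<open>
  This is semi-perfectness in a form that can be checked on the letters, see
  \<open>admissible_semi_perfect\<close> and \<open>semi_perfect_admissible\<close>.
\<close>

definition admissible :: "letter list \<Rightarrow> bool" where
  "admissible Y \<longleftrightarrow> sorted (map letter_index Y) \<and>
     (\<exists>(m, n)\<in>E_pairs. \<forall>c. CL c \<in> set Y \<longrightarrow> c \<in> {C1, C2, C3, C4, m, n})"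

text \<open>
  Ignoring multiplicities is enough here: some root vector in the word of \<open>c\<close> is missing from all
  later generators that may occur together.  The proof runs through the twelve generators and
  eight edges.
\<close>

lemma edge_no_smaller_factor:
  assumes "(m, n) \<in> E_pairs"
  shows "\<exists>b\<in>set (c_word c). \<forall>y\<in>{C1, C2, C3, C4, m, n}. c_index c < c_index y \<longrightarrow> b \<notin> set (c_word y)"
  using assms unfolding E_pairs_def
  by (elim insertE emptyE Pair_inject; hypsubst; cases c; simp add: ex_disj_distrib)

text \<open>
  The two generators of an edge bound a common sector, on which no surplus changes sign.  So they
  never contribute opposite root vectors.
\<close>

lemma edge_no_opposite_letters:
  assumes "(m, n) \<in> E_pairs" and "z \<in> {C1, C2, C3, C4}"
  shows "\<exists>b\<in>set (c_word z). \<forall>y\<in>{C1, C2, C3, C4, m, n}. y \<noteq> z \<longrightarrow> b \<notin> set (c_word y)"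
  using assms unfolding E_pairs_def
  by (elim insertE emptyE Pair_inject; hypsubst; simp)

lemma h_elem_notin_c_word: "h_elem h \<notin> set (c_word c)"
  by (cases h; cases c; simp)

lemma in_set_omega: "b \<in> set (omega Y) \<longleftrightarrow> (\<exists>l\<in>set Y. b \<in> set (letter_word l))"
  by (induction Y) auto

lemma c_letter_in_omega:
  assumes "b \<in> set (c_word c)" and "b \<in> set (omega Y)"
  shows "\<exists>y. CL y \<in> set Y \<and> b \<in> set (c_word y)"
proof -
  from assms(2) obtain l where l: "l \<in> set Y" "b \<in> set (letter_word l)" by (auto simp: in_set_omega)
  show ?thesis
  proof (cases l)
    case (HL h)
    then show ?thesis using l assms(1) h_elem_notin_c_word[of h c] by simp
  qed (use l in auto)
qed

lemma admissible_opposite_letters: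
  assumes "admissible Y" and "z \<in> {C1, C2, C3, C4}" and "set (c_word z) \<subseteq> set (omega Y)"
  shows "CL z \<in> set Y"
proof -
  from assms(1) obtain m n where mn: "(m, n) \<in> E_pairs"
    and Y: "\<And>c. CL c \<in> set Y \<Longrightarrow> c \<in> {C1, C2, C3, C4, m, n}"
    by (auto simp: admissible_def)
  obtain b where b: "b \<in> set (c_word z)" "\<And>y. y \<in> {C1, C2, C3, C4, m, n} \<Longrightarrow> y \<noteq> z \<Longrightarrow> b \<notin> set (c_word y)"
    using edge_no_opposite_letters[OF mn assms(2)] by blast
  obtain y where "CL y \<in> set Y" "b \<in> set (c_word y)"
    using c_letter_in_omega[OF b(1), of Y] b(1) assms(3) by blast
  then show ?thesis using b(2)[of y] Y[of y] by auto
qed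

lemma admissible_first_letter:
  assumes "admissible Y" and smaller: "\<And>l. l \<in> set Y \<Longrightarrow> letter_index z < letter_index l"
  shows "\<not> set (letter_word z) \<subseteq> set (omega Y)"
proof
  assume sub: "set (letter_word z) \<subseteq> set (omega Y)"
  from assms(1) obtain m n where mn: "(m, n) \<in> E_pairs"
    and Y: "\<And>c. CL c \<in> set Y \<Longrightarrow> c \<in> {C1, C2, C3, C4, m, n}"
    by (auto simp: admissible_def)
  show False
  proof (cases z)
    case (HL h)
    with sub obtain l where l: "l \<in> set Y" "h_elem h \<in> set (letter_word l)" by (auto simp: in_set_omega)
    have "l = HL h"
    proof (cases l)
      case (HL h')
      then show ?thesis using l(2) by (cases h; cases h') simp_all
    qed (use l(2) h_elem_notin_c_word in auto)
    then show False using smaller[OF l(1)] HL by simp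
  next
    case (CL c)
    obtain b where b: "b \<in> set (c_word c)"
      "\<And>y. y \<in> {C1, C2, C3, C4, m, n} \<Longrightarrow> c_index c < c_index y \<Longrightarrow> b \<notin> set (c_word y)"
      using edge_no_smaller_factor[OF mn, of c] by blast
    obtain y where "CL y \<in> set Y" "b \<in> set (c_word y)"
      using c_letter_in_omega[OF b(1), of Y] b(1) sub CL by auto
    then show False using b(2)[of y] Y[of y] smaller[of "CL y"] CL by auto
  qed
qed

abbreviation letter_order :: "(letter \<times> letter) set" where
  "letter_order \<equiv> {(x, y). letter_less x y}"

lemma admissible_tail: "admissible (y # Y) \<Longrightarrow> admissible Y"
  unfolding admissible_def by (auto simp: case_prod_beta)

text \<open>
  After removal of a common prefix the first letters differ.  If \<open>Y'\<close> went on with the smaller one,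
  the word of this letter would consist of basis vectors occurring in the rest of \<open>Y\<close>,
  contrary to \<open>admissible_first_letter\<close>.
\<close>

lemma admissible_minimal:
  assumes "admissible Y" and "equivalent Y Y'" and "Y' \<noteq> Y"
  shows "(Y, Y') \<in> lexord letter_order"
  using assms
proof (induction Y arbitrary: Y')
  case Nil
  then show ?case by (cases Y') (auto simp: equivalent_def)
next
  case (Cons y Y)
  obtain z Z where Y': "Y' = z # Z" using Cons.prems(2) by (cases Y') (auto simp: equivalent_def)
  show ?case
  proof (cases "y = z")
    case True
    then show ?thesis using Cons Y' by (auto simp: equivalent_def dest: admissible_tail)
  next
    case False
    have "letter_index y < letter_index z"
    proof (rule ccontr)
      assume "\<not> letter_index y < letter_index z"
      then have "letter_index z < letter_index y" using False letter_index_inj[of y z] by force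
      moreover have "letter_index y \<le> letter_index l" if "l \<in> set (y # Y)" for l
        using Cons.prems(1) that by (auto simp: admissible_def)
      ultimately have "letter_index z < letter_index l" if "l \<in> set (y # Y)" for l
        using that le_less_trans less_le_trans by blast
      then have "\<not> set (letter_word z) \<subseteq> set (omega (y # Y))"
        by (rule admissible_first_letter[OF Cons.prems(1)])
      moreover have "set (omega (y # Y)) = set (omega Y')"
        using Cons.prems(2) by (metis equivalent_def set_mset_mset)
      ultimately show False by (auto simp: Y')
    qed
    then show ?thesis by (simp add: Y' letter_less_iff)
  qed
qed

lemma admissible_semi_perfect: "admissible Y \<Longrightarrow> semi_perfect Y"
  unfolding semi_perfect_def using admissible_minimal by blast

lemma lexord_letter_order_asym: "(Y, Y') \<in> lexord letter_order \<Longrightarrow> (Y', Y) \<notin> lexord letter_order"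
proof -
  have "asym letter_order" by (rule asymI) (auto simp: letter_less_iff)
  then show "(Y, Y') \<in> lexord letter_order \<Longrightarrow> (Y', Y) \<notin> lexord letter_order"
    by (meson asymD lexord_asym)
qed

lemma semi_perfect_unique:
  assumes "semi_perfect Y" and "semi_perfect Y'" and "equivalent Y Y'"
  shows "Y = Y'"
proof (rule ccontr)
  assume "Y \<noteq> Y'"
  then have "(Y, Y') \<in> lexord letter_order" "(Y', Y) \<in> lexord letter_order"
    using assms unfolding semi_perfect_def equivalent_def by metis+
  then show False using lexord_letter_order_asym by blast
qed

definition P_word :: "nat \<Rightarrow> nat \<Rightarrow> nat \<Rightarrow> nat \<Rightarrow> nat \<Rightarrow> nat \<Rightarrow> c_letter \<Rightarrow> nat \<Rightarrow> c_letter \<Rightarrow> nat \<Rightarrow> letter list" where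
  "P_word s1 s2 s3 s4 s5 s6 m sm n sn =
     replicate s1 (HL H1) @ replicate s2 (HL H2) @ replicate s3 (CL C1) @ replicate s4 (CL C2) @
     replicate s5 (CL C3) @ replicate s6 (CL C4) @ replicate sm (CL m) @ replicate sn (CL n)"

lemma admissible_P_word:
  assumes "(m, n) \<in> E_pairs"
  shows "admissible (P_word s1 s2 s3 s4 s5 s6 m sm n sn)"
proof -
  have "4 < c_index m \<and> c_index m < c_index n" using assms by (auto simp: E_pairs_def)
  then have "sorted (map letter_index (P_word s1 s2 s3 s4 s5 s6 m sm n sn))"
    by (auto simp: P_word_def sorted_append)
  moreover have "\<forall>c. CL c \<in> set (P_word s1 s2 s3 s4 s5 s6 m sm n sn) \<longrightarrow> c \<in> {C1, C2, C3, C4, m, n}"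
    by (auto simp: P_word_def)
  ultimately show ?thesis using assms unfolding admissible_def by blast
qed

lemma mset_eq_if_letter_counts:
  assumes "set v \<subseteq> c2_letters" and "set w \<subseteq> c2_letters"
    and "\<And>b. b \<in> c2_letters \<Longrightarrow> count (mset v) b = count (mset w) b"
  shows "mset v = mset w"
proof (rule multiset_eqI)
  fix b show "count (mset v) b = count (mset w) b"
  proof (cases "b \<in> c2_letters")
    case False
    then have "b \<notin># mset v" "b \<notin># mset w" using assms(1,2) by auto
    then show ?thesis by (simp add: count_eq_zero_iff[THEN iffD2])
  qed (use assms(3) in auto)
qed

lemma count_omega_replicate:
  "count (mset (omega (replicate s l))) b = s * count (mset (letter_word l)) b"
  by (induction s) simp_all

lemma word_weight_counts:
  assumes "set w \<subseteq> c2_letters"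
  shows "Re (word_weight w) = real (count (mset w) e10) + real (count (mset w) e11)
      + 2 * real (count (mset w) e21) - real (count (mset w) f10) - real (count (mset w) f11)
      - 2 * real (count (mset w) f21)" (is ?A)
    and "Im (word_weight w) = real (count (mset w) e01) + real (count (mset w) e11)
      + real (count (mset w) e21) - real (count (mset w) f01) - real (count (mset w) f11)
      - real (count (mset w) f21)" (is ?B)
proof -
  have "?A \<and> ?B" using assms
  proof (induction w)
    case (Cons b w)
    then have "b \<in> c2_letters" by simp
    then show ?case using Cons unfolding c2_letters_def
      by (elim insertE emptyE) (simp_all add: weight_simps)
  qed simp
  then show ?A ?B by blast+
qed

text \<open>
  For each positive root, as many pairs of opposite root vectors as possible are split off; this
  gives the exponents of the first four generators.  Then the surpluses \<open>a\<close> and \<open>b\<close> of positive over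
  negative root vectors at the two non-simple roots determine the other two surpluses \<open>-a - 2b\<close>
  and \<open>-a - b\<close>.  The lines on which one of the four surpluses vanishes cut the plane into eight
  sectors.  The boundary rays of the sectors are the generators from \<^const>\<open>C5\<close> on.  The two rays
  bounding a sector form an edge, and the lattice points of the sector are their nonnegative
  integral combinations.
\<close>

lemma toric_factorization:
  fixes N :: "c2 \<Rightarrow> nat"
  assumes "N e10 + N e11 + 2 * N e21 = N f10 + N f11 + 2 * N f21"
    and "N e01 + N e11 + N e21 = N f01 + N f11 + N f21"
  obtains m n s3 s4 s5 s6 sm sn where "(m, n) \<in> E_pairs"
    and "\<forall>b\<in>{e10, e01, e11, e21, f10, f01, f11, f21}. \<forall>s1 s2.
      count (mset (omega (P_word s1 s2 s3 s4 s5 s6 m sm n sn))) b = N b"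
proof -
  define s3 s4 s5 s6 where s: "s3 = min (N e01) (N f01)" "s4 = min (N e21) (N f21)"
    "s5 = min (N e10) (N f10)" "s6 = min (N e11) (N f11)"
  define a b where "a = int (N e11) - int (N f11)" and "b = int (N e21) - int (N f21)"
  have ab: "int (N e10) = int (N f10) - a - 2 * b" "int (N e01) = int (N f01) - a - b"
      "int (N e11) = int (N f11) + a" "int (N e21) = int (N f21) + b"
    using assms by (simp_all add: a_def b_def)
  note counts = P_word_def count_omega_replicate s
  consider "a \<le> 0" "b \<le> 0" | "a \<ge> 0" "b \<ge> 0" | "a \<ge> 0" "a + b \<le> 0" | "a + b \<ge> 0" "a + 2 * b \<le> 0"
    | "a + 2 * b \<ge> 0" "b \<le> 0" | "a \<le> 0" "a + b \<ge> 0" | "a + b \<le> 0" "a + 2 * b \<ge> 0"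
    | "a + 2 * b \<le> 0" "b \<ge> 0"
    by linarith
  then show thesis
  proof cases
    case 1
    show thesis
      by (rule that[of C5 C9 s3 s4 s5 s6 "nat (- a)" "nat (- b)"])
        (simp add: E_pairs_def, use 1 ab in \<open>intro ballI allI; elim insertE emptyE; simp add: counts; arith\<close>)
  next
    case 2
    show thesis
      by (rule that[of C6 C10 s3 s4 s5 s6 "nat a" "nat b"])
        (simp add: E_pairs_def, use 2 ab in \<open>intro ballI allI; elim insertE emptyE; simp add: counts; arith\<close>)
  next
    case 3
    show thesis
      by (rule that[of C7 C9 s3 s4 s5 s6 "nat a" "nat (- a - b)"])
        (simp add: E_pairs_def, use 3 ab in \<open>intro ballI allI; elim insertE emptyE; simp add: counts; arith\<close>)
  next
    case 4
    show thesis
      by (rule that[of C7 C11 s3 s4 s5 s6 "nat (- a - 2 * b)" "nat (a + b)"])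
        (simp add: E_pairs_def, use 4 ab in \<open>intro ballI allI; elim insertE emptyE; simp add: counts; arith\<close>)
  next
    case 5
    show thesis
      by (rule that[of C6 C11 s3 s4 s5 s6 "nat (a + 2 * b)" "nat (- b)"])
        (simp add: E_pairs_def, use 5 ab in \<open>intro ballI allI; elim insertE emptyE; simp add: counts; arith\<close>)
  next
    case 6
    show thesis
      by (rule that[of C8 C10 s3 s4 s5 s6 "nat (- a)" "nat (a + b)"])
        (simp add: E_pairs_def, use 6 ab in \<open>intro ballI allI; elim insertE emptyE; simp add: counts; arith\<close>)
  next
    case 7
    show thesis
      by (rule that[of C8 C12 s3 s4 s5 s6 "nat (a + 2 * b)" "nat (- a - b)"])
        (simp add: E_pairs_def, use 7 ab in \<open>intro ballI allI; elim insertE emptyE; simp add: counts; arith\<close>)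
  next
    case 8
    show thesis
      by (rule that[of C5 C12 s3 s4 s5 s6 "nat (- a - 2 * b)" "nat b"])
        (simp add: E_pairs_def, use 8 ab in \<open>intro ballI allI; elim insertE emptyE; simp add: counts; arith\<close>)
  qed
qed

lemma P_word_exists:
  assumes w: "set w \<subseteq> c2_letters" and "word_weight w = 0"
  obtains s1 s2 s3 s4 s5 s6 m sm n sn where "(m, n) \<in> E_pairs"
    and "mset (omega (P_word s1 s2 s3 s4 s5 s6 m sm n sn)) = mset w"
proof -
  let ?N = "count (mset w)"
  have "real (?N e10 + ?N e11 + 2 * ?N e21) = real (?N f10 + ?N f11 + 2 * ?N f21)"
    and "real (?N e01 + ?N e11 + ?N e21) = real (?N f01 + ?N f11 + ?N f21)"
    using word_weight_counts[OF w] assms(2) by simp_all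
  then have eqs: "?N e10 + ?N e11 + 2 * ?N e21 = ?N f10 + ?N f11 + 2 * ?N f21"
    "?N e01 + ?N e11 + ?N e21 = ?N f01 + ?N f11 + ?N f21"
    unfolding of_nat_eq_iff by blast+
  obtain m n s3 s4 s5 s6 sm sn where mn: "(m, n) \<in> E_pairs"
    and "\<forall>b\<in>{e10, e01, e11, e21, f10, f01, f11, f21}. \<forall>s1 s2.
      count (mset (omega (P_word s1 s2 s3 s4 s5 s6 m sm n sn))) b = ?N b"
    by (rule toric_factorization[of ?N, OF eqs])
  moreover have "count (mset (omega (P_word (?N h01) (?N h10) s3 s4 s5 s6 m sm n sn))) b = ?N b"
    if "b \<in> {h01, h10}" for b
    using that mn unfolding E_pairs_def
    by (elim insertE emptyE Pair_inject) (simp_all add: P_word_def count_omega_replicate)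
  ultimately have "mset (omega (P_word (?N h01) (?N h10) s3 s4 s5 s6 m sm n sn)) = mset w"
    by (intro mset_eq_if_letter_counts omega_letters w) (auto simp: c2_letters_def)
  then show thesis using that mn by blast
qed

lemma semi_perfect_iff_P_word:
  "semi_perfect Y \<longleftrightarrow> (\<exists>s1 s2 s3 s4 s5 s6 m sm n sn. (m, n) \<in> E_pairs \<and> Y = P_word s1 s2 s3 s4 s5 s6 m sm n sn)"
proof
  assume Y: "semi_perfect Y"
  obtain s1 s2 s3 s4 s5 s6 m sm n sn where mn: "(m, n) \<in> E_pairs"
    and "mset (omega (P_word s1 s2 s3 s4 s5 s6 m sm n sn)) = mset (omega Y)"
    by (rule P_word_exists[OF omega_letters omega_weight])
  then have "Y = P_word s1 s2 s3 s4 s5 s6 m sm n sn"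
    by (intro semi_perfect_unique[OF Y] admissible_semi_perfect admissible_P_word)
      (simp_all add: equivalent_def)
  then show "\<exists>s1 s2 s3 s4 s5 s6 m sm n sn. (m, n) \<in> E_pairs \<and> Y = P_word s1 s2 s3 s4 s5 s6 m sm n sn"
    using mn by blast
qed (use admissible_semi_perfect admissible_P_word in blast)

lemma semi_perfect_admissible: "semi_perfect Y \<Longrightarrow> admissible Y"
  unfolding semi_perfect_iff_P_word by (auto intro: admissible_P_word)

lemma semi_perfect_exists:
  assumes "set w \<subseteq> c2_letters" and "word_weight w = 0"
  obtains Y where "semi_perfect Y" and "mset (omega Y) = mset w"
  using P_word_exists[OF assms] admissible_semi_perfect admissible_P_word by metis

text \<open>
  A word of weight zero differs from the semi-perfect word with the same letters by shorter words
  of weight zero, so that induction on the length applies.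
\<close>

lemma semi_perfect_span:
  assumes "u \<in> values_below k 0"
  shows "u \<in> uea.span ((\<lambda>Y. word_value (omega Y)) ` {Y. semi_perfect Y \<and> length (omega Y) < k})"
  using assms
proof (induction k arbitrary: u)
  case 0
  then show ?case by (simp add: values_below_def words_below_def)
next
  case (Suc k)
  let ?S = "\<lambda>k. uea.span ((\<lambda>Y. word_value (omega Y)) ` {Y. semi_perfect Y \<and> length (omega Y) < k})"
  have mono: "?S k \<subseteq> ?S (Suc k)" by (rule uea.span_mono) auto
  have "word_value w \<in> ?S (Suc k)" if w: "w \<in> words_below (Suc k) 0" for w
  proof -
    from w have w': "set w \<subseteq> c2_letters" "word_weight w = 0" "length w \<le> k"
      by (auto simp: words_below_def)
    obtain Y where Y: "semi_perfect Y" "mset (omega Y) = mset w"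
      by (rule semi_perfect_exists[OF w'(1,2)])
    have len: "length (omega Y) = length w" using mset_eq_length[OF Y(2)] .
    have "values_below (length w) 0 \<subseteq> values_below k 0"
      unfolding values_below_def by (rule uea.span_mono) (use w'(3) in \<open>auto simp: words_below_def\<close>)
    moreover have "word_value w - word_value (omega Y) \<in> values_below (length w) 0"
      using permuted_words[OF Y(2)[symmetric] w'(1)] w'(2) by simp
    ultimately have "word_value w - word_value (omega Y) \<in> ?S (Suc k)"
      using Suc.IH mono by blast
    moreover have "word_value (omega Y) \<in> ?S (Suc k)"
      by (rule uea.span_base) (use Y(1) len w'(3) in auto)
    ultimately have "(word_value w - word_value (omega Y)) + word_value (omega Y) \<in> ?S (Suc k)"
      by (rule uea.span_add)
    then show ?thesis by simp
  qed
  then have "values_below (Suc k) 0 \<subseteq> ?S (Suc k)"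
    unfolding values_below_def by (intro uea.span_minimal) auto
  then show ?case using Suc.prems by blast
qed

section \<open>The homomorphism onto the centralizer\<close>

lemma cartan_letters: "h_elem h \<in> cartan"
  unfolding cartan_def by (cases h) (auto intro: lie.span_base)

lemma U0_commutes: "u \<in> U0 \<Longrightarrow> uea_incl (h_elem h) * u = u * uea_incl (h_elem h)"
  using cartan_letters by (simp add: U0_def)

lemma cartan_commutes:
  "uea_incl (h_elem h) * uea_incl (h_elem h') = uea_incl (h_elem h') * uea_incl (h_elem h)"
proof -
  have "lie_bracket (h_elem h) (h_elem h') = 0"
    by (cases h; cases h') (simp_all add: cartan_action c2_letters_def weight_simps)
  then show ?thesis using uea_incl_bracket[of "h_elem h" "h_elem h'"] by (simp add: uea_incl_zero)
qed

lemma powers_commute: "x * y = y * x \<Longrightarrow> x ^ a * y ^ b = y ^ b * x ^ a" for x y :: "'a::monoid_mult"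
  by (metis power_commuting_commutes)

lemma h_poly_value_eq: "h_poly_value = linear_extension (\<lambda>m a. uea_scale a
    (uea_incl (h_elem H1) ^ Poly_Mapping.lookup m H1 * uea_incl (h_elem H2) ^ Poly_Mapping.lookup m H2))"
  by (rule ext) (simp add: h_poly_value_def linear_extension_def)

lemma h_poly_value_add: "h_poly_value (p + q) = h_poly_value p + h_poly_value q"
  unfolding h_poly_value_eq by (rule linear_extension_add) (rule uea.scale_left_distrib)

lemma h_poly_value_single: "h_poly_value (Poly_Mapping.single m a) = uea_scale a
    (uea_incl (h_elem H1) ^ Poly_Mapping.lookup m H1 * uea_incl (h_elem H2) ^ Poly_Mapping.lookup m H2)"
  unfolding h_poly_value_eq by (rule linear_extension_single) simp

lemma h_poly_value_mult: "h_poly_value (p * q) = h_poly_value p * h_poly_value q"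
  unfolding h_poly_value_eq
proof (rule linear_extension_mult)
  let ?x = "uea_incl (h_elem H1)" and ?y = "uea_incl (h_elem H2)"
  fix k l :: "h_letter \<Rightarrow>\<^sub>0 nat" and a b :: complex
  let ?k1 = "Poly_Mapping.lookup k H1" and ?k2 = "Poly_Mapping.lookup k H2"
  let ?l1 = "Poly_Mapping.lookup l H1" and ?l2 = "Poly_Mapping.lookup l H2"
  have "?x ^ (?k1 + ?l1) * ?y ^ (?k2 + ?l2) = ?x ^ ?k1 * (?x ^ ?l1 * ?y ^ ?k2) * ?y ^ ?l2"
    by (simp add: power_add mult.assoc)
  also have "\<dots> = (?x ^ ?k1 * ?y ^ ?k2) * (?x ^ ?l1 * ?y ^ ?l2)"
    by (subst powers_commute[OF cartan_commutes]) (simp add: mult.assoc)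
  finally show "uea_scale (a * b) (?x ^ Poly_Mapping.lookup (k + l) H1 * ?y ^ Poly_Mapping.lookup (k + l) H2)
      = uea_scale a (?x ^ ?k1 * ?y ^ ?k2) * uea_scale b (?x ^ ?l1 * ?y ^ ?l2)"
    by (simp add: lookup_add uea_scale_mult_left uea_scale_mult_right)
qed (rule uea.scale_left_distrib)

lemma h_poly_value_commutes:
  assumes "u \<in> U0"
  shows "h_poly_value p * u = u * h_poly_value p"
proof (induction p rule: poly_mapping_single_induct)
  case (add m a p)
  let ?x = "uea_incl (h_elem H1)" and ?y = "uea_incl (h_elem H2)"
  have "?x ^ i * ?y ^ j * u = u * (?x ^ i * ?y ^ j)" for i j
  proof -
    have "?x ^ i * ?y ^ j * u = ?x ^ i * u * ?y ^ j"
      using powers_commute[OF U0_commutes[OF assms, of H2], of j 1] by (simp add: mult.assoc)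
    also have "\<dots> = u * (?x ^ i * ?y ^ j)"
      using powers_commute[OF U0_commutes[OF assms, of H1], of i 1] by (simp add: mult.assoc)
    finally show ?thesis .
  qed
  with add show ?case
    by (simp add: h_poly_value_add h_poly_value_single distrib_left distrib_right
        uea_scale_mult_left uea_scale_mult_right)
qed (simp add: h_poly_value_eq)

lemma c_values_eq: "prod_list (map c_value w) = word_value (omega (map CL w))"
  by (induction w) (simp_all add: c_value_def word_value_def)

lemma omega_value_in_U0: "word_value (omega Y) \<in> U0"
  by (rule zero_weight_word_in_U0[OF omega_letters omega_weight])

lemma to_U_eq: "to_U = linear_extension (\<lambda>w p. h_poly_value p * prod_list (map c_value w))"
  by (rule ext) (simp add: to_U_def linear_extension_def)

lemma to_U_add: "to_U (X + Y) = to_U X + to_U Y"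
  unfolding to_U_eq by (rule linear_extension_add) (simp add: h_poly_value_add distrib_right)

lemma to_U_diff: "to_U (X - Y) = to_U X - to_U Y"
  unfolding to_U_eq by (rule linear_extension_diff) (simp add: h_poly_value_add distrib_right)

lemma to_U_single: "to_U (Poly_Mapping.single w p) = h_poly_value p * prod_list (map c_value w)"
  unfolding to_U_eq by (rule linear_extension_single) (simp add: h_poly_value_eq)

lemma to_U_zero: "to_U 0 = 0"
  by (simp add: to_U_eq)

text \<open>
  Multiplicativity holds because the coefficients of the free algebra become polynomials in the
  Cartan generators, which commute with the centralizer and thus with the values of words.
\<close>

lemma to_U_mult: "to_U (X * Y) = to_U X * to_U Y"
  unfolding to_U_eq
proof (rule linear_extension_mult)
  fix v w :: "c_letter list" and p q :: h_poly
  have "h_poly_value q * prod_list (map c_value v) = prod_list (map c_value v) * h_poly_value q"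
    unfolding c_values_eq by (rule h_poly_value_commutes[OF omega_value_in_U0])
  then show "h_poly_value (p * q) * prod_list (map c_value (v + w))
      = h_poly_value p * prod_list (map c_value v) * (h_poly_value q * prod_list (map c_value w))"
    by (simp add: h_poly_value_mult plus_list_def mult.assoc) (simp flip: mult.assoc)
qed (simp add: h_poly_value_add distrib_right)

lemma h_poly_value_one: "h_poly_value 1 = 1"
  using h_poly_value_single[of 0 1] by simp

lemma single_Nil: "Poly_Mapping.single [] 1 = (1 :: 'a list \<Rightarrow>\<^sub>0 'b::zero_neq_one)"
  by (simp flip: zero_list_def)

lemma to_U_one: "to_U 1 = 1"
  using to_U_single[of "[]" 1] by (simp add: h_poly_value_one single_Nil)

lemma to_U_scale: "to_U (F_scale a X) = uea_scale a (to_U X)"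
  by (simp add: F_scale_def to_U_mult to_U_single h_poly_value_single uea_scale_mult_left)

lemma to_U_letter: "to_U (letter_F l) = word_value (letter_word l)"
proof (cases l)
  case (HL h)
  then show ?thesis
    by (cases h) (simp_all add: hF_def to_U_single h_poly_value_single lookup_single)
next
  case (CL c)
  then show ?thesis
    by (simp add: cF_def to_U_single h_poly_value_one c_value_def word_value_def)
qed

lemma word_F_simps [simp]:
  "word_F [] = 1" "word_F (l # Y) = letter_F l * word_F Y" "word_F (Y @ Z) = word_F Y * word_F Z"
  by (simp_all add: word_F_def)

lemma to_U_word: "to_U (word_F Y) = word_value (omega Y)"
  by (induction Y) (simp_all add: to_U_one to_U_mult to_U_letter)

lemma hF_power: "hF h ^ n = Poly_Mapping.single [] (Poly_Mapping.single (Poly_Mapping.single h n) 1)"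
proof (induction n)
  case 0
  show ?case by (simp flip: zero_list_def)
next
  case (Suc n)
  then show ?case
    by (simp add: hF_def mult_single plus_list_def flip: single_add)
qed

lemma hF_commutes: "hF h * X = X * hF h"
proof (induction X rule: poly_mapping_single_induct)
  case (add w p X)
  then show ?case by (simp add: hF_def distrib_left distrib_right mult_single plus_list_def mult.commute)
qed simp

lemma F_scale_mult_left: "F_scale a X * Y = F_scale a (X * Y)"
  by (simp add: F_scale_def mult.assoc)

lemma F_scale_mult_right: "X * F_scale a Y = F_scale a (X * Y)"
proof -
  have "Poly_Mapping.single [] (Poly_Mapping.single 0 a) * X = X * Poly_Mapping.single [] (Poly_Mapping.single 0 a)"
  proof (induction X rule: poly_mapping_single_induct)
    case (add w p X)
    then show ?case by (simp add: distrib_left distrib_right mult_single plus_list_def mult.commute)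
  qed simp
  then show ?thesis by (simp add: F_scale_def flip: mult.assoc)
qed

lemma word_F_replicate: "word_F (replicate n l) = letter_F l ^ n"
  by (simp add: word_F_def)

lemma F_span_words: "X \<in> F.span (range word_F)"
proof (induction X rule: poly_mapping_single_induct)
  case zero
  show ?case by (rule F.span_zero)
next
  case (add w p X)
  have "Poly_Mapping.single w p \<in> F.span (range word_F)"
  proof (induction p rule: poly_mapping_single_induct)
    case zero
    show ?case by (simp add: F.span_zero)
  next
    case (add m a p)
    let ?Y = "replicate (Poly_Mapping.lookup m H1) (HL H1) @ replicate (Poly_Mapping.lookup m H2) (HL H2)
      @ map CL w"
    have m: "m = Poly_Mapping.single H1 (Poly_Mapping.lookup m H1) + Poly_Mapping.single H2 (Poly_Mapping.lookup m H2)"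
    proof (rule poly_mapping_eqI)
      fix h show "Poly_Mapping.lookup m h = Poly_Mapping.lookup (Poly_Mapping.single H1 (Poly_Mapping.lookup m H1)
          + Poly_Mapping.single H2 (Poly_Mapping.lookup m H2)) h"
        by (cases h) (simp_all add: lookup_add lookup_single)
    qed
    have cs: "word_F (map CL w) = Poly_Mapping.single w 1"
    proof (induction w)
      case Nil
      show ?case by (simp add: single_Nil)
    qed (simp add: cF_def mult_single plus_list_def)
    have "word_F ?Y = Poly_Mapping.single w (Poly_Mapping.single m 1)"
      by (subst (3) m) (simp add: word_F_replicate hF_power mult_single plus_list_def cs)
    then have "Poly_Mapping.single w (Poly_Mapping.single m a) = F_scale a (word_F ?Y)"
      by (simp add: F_scale_def mult_single plus_list_def)
    then show ?case
      unfolding single_add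
      by (simp only:) (intro F.span_add[OF F.span_scale[OF F.span_base[OF rangeI]] add])
  qed
  then show ?case using add by (rule F.span_add)
qed

lemma P_monomials_eq: "P_monomials = word_F ` {Y. semi_perfect Y}"
proof -
  have eq: "word_F (P_word s1 s2 s3 s4 s5 s6 m sm n sn) = hF H1 ^ s1 * hF H2 ^ s2 * cF C1 ^ s3
      * cF C2 ^ s4 * cF C3 ^ s5 * cF C4 ^ s6 * cF m ^ sm * cF n ^ sn" for s1 s2 s3 s4 s5 s6 m sm n sn
    by (simp add: P_word_def word_F_replicate mult.assoc)
  show ?thesis
    unfolding P_monomials_def semi_perfect_iff_P_word by (auto simp: image_iff) (use eq in metis)+
qed

section \<open>The basis of the centralizer\<close>

text \<open>
  Different semi-perfect words have different multisets of letters, as each of them is the unique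
  minimal element of its class.
\<close>

lemma semi_perfect_values_independent:
  assumes "finite S" and "\<And>Y. Y \<in> S \<Longrightarrow> semi_perfect Y"
    and "(\<Sum>Y\<in>S. uea_scale (a Y) (word_value (omega Y))) = 0" and "Y \<in> S"
  shows "a Y = 0"
proof (rule c2_word_values_independent[where word = omega, OF assms(1) omega_letters _ assms(3,4)])
  show "inj_on (\<lambda>Y. mset (omega Y)) S"
    using assms(2) semi_perfect_unique by (auto simp: inj_on_def equivalent_def)
qed

lemma to_U_injective_on_normal_forms:
  assumes "X \<in> F.span (word_F ` {Y. semi_perfect Y})" and "to_U X = 0"
  shows "X = 0"
proof -
  obtain T r where T: "finite T" "T \<subseteq> word_F ` {Y. semi_perfect Y}" and X: "X = (\<Sum>v\<in>T. F_scale (r v) v)"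
    using assms(1) unfolding F.span_explicit by blast
  obtain S where S: "S \<subseteq> {Y. semi_perfect Y}" "finite S" "T = word_F ` S" "inj_on word_F S"
    using T subset_image_inj[of T word_F] finite_imageD[of word_F] by metis
  have X': "X = (\<Sum>Y\<in>S. F_scale (r (word_F Y)) (word_F Y))"
    unfolding X S(3) by (simp add: sum.reindex[OF S(4)])
  have "to_U X = (\<Sum>Y\<in>S. uea_scale (r (word_F Y)) (word_value (omega Y)))"
  proof -
    have "to_U (\<Sum>Y\<in>S. f Y) = (\<Sum>Y\<in>S. to_U (f Y))" for f
      using S(2) by (induction S rule: finite_induct) (simp_all add: to_U_zero to_U_add)
    then show ?thesis by (simp add: X' to_U_scale to_U_word)
  qed
  then have "r (word_F Y) = 0" if "Y \<in> S" for Y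
    using semi_perfect_values_independent[OF S(2), of "\<lambda>Y. r (word_F Y)" Y] S(1) that assms(2) by auto
  then show "X = 0" by (simp add: X')
qed

lemma semi_perfect_value_inj: "inj_on (\<lambda>Y. word_value (omega Y)) {Y. semi_perfect Y}"
proof (rule inj_onI, rule ccontr)
  fix Y Y' assume Y: "Y \<in> {Y. semi_perfect Y}" "Y' \<in> {Y. semi_perfect Y}"
    "word_value (omega Y) = word_value (omega Y')" "Y \<noteq> Y'"
  have "(if Y = Y then 1 else - 1 :: complex) = 0"
  proof (rule semi_perfect_values_independent[where S = "{Y, Y'}" and Y = Y
        and a = "\<lambda>Z. if Z = Y then 1 else - 1"])
    show "(\<Sum>Z\<in>{Y, Y'}. uea_scale (if Z = Y then 1 else - 1) (word_value (omega Z))) = 0"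
      using Y(3,4) by simp
  qed (use Y in auto)
  then show False by simp
qed

lemma to_U_span_image:
  assumes "u \<in> uea.span (to_U ` S)"
  shows "\<exists>Z\<in>F.span S. to_U Z = u"
  using assms
proof (induction u rule: uea.span_induct_alt)
  case base
  show ?case using F.span_zero to_U_zero by blast
next
  case (step c x y)
  then obtain X Z where "X \<in> S" "x = to_U X" "Z \<in> F.span S" "to_U Z = y" by auto
  then show ?case
    by (intro bexI[of _ "F_scale c X + Z"])
      (simp_all add: to_U_add to_U_scale F.span_add F.span_scale F.span_base)
qed

theorem U0_spanned: "uea.span ((\<lambda>Y. word_value (omega Y)) ` {Y. semi_perfect Y}) = U0"
proof
  show "uea.span ((\<lambda>Y. word_value (omega Y)) ` {Y. semi_perfect Y}) \<subseteq> U0"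
    by (intro uea.span_minimal U0_subspace) (use omega_value_in_U0 in auto)
  show "U0 \<subseteq> uea.span ((\<lambda>Y. word_value (omega Y)) ` {Y. semi_perfect Y})" (is "_ \<subseteq> ?S")
  proof
    fix u assume "u \<in> U0"
    then have "u \<in> uea.span (word_value ` {w \<in> {w. set w \<subseteq> c2_letters}. word_weight w = 0})"
      by (rule U0_zero_weight_part) (use span_letter_words in auto)
    moreover have word: "word_value w \<in> ?S" if "set w \<subseteq> c2_letters" "word_weight w = 0" for w
    proof -
      have "word_value w \<in> values_below (Suc (length w)) 0"
        using word_value_below[OF that(1), of "Suc (length w)"] that(2) by simp
      from semi_perfect_span[OF this] show ?thesis
        by (rule rev_subsetD) (intro uea.span_mono image_mono, blast)
    qed
    have "uea.span (word_value ` {w \<in> {w. set w \<subseteq> c2_letters}. word_weight w = 0}) \<subseteq> ?S"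
      by (intro uea.span_minimal uea.subspace_span) (auto intro: word)
    ultimately show "u \<in> ?S" by blast
  qed
qed

theorem P_values_basis:
  "inj_on to_U P_monomials" "uea.independent (to_U ` P_monomials)" "uea.span (to_U ` P_monomials) = U0"
proof -
  let ?SP = "{Y. semi_perfect Y}" and ?val = "\<lambda>Y. word_value (omega Y)"
  have img: "to_U ` P_monomials = ?val ` ?SP"
    by (simp add: P_monomials_eq image_image to_U_word)
  show "inj_on to_U P_monomials"
    using semi_perfect_value_inj unfolding P_monomials_eq inj_on_def by (auto simp: to_U_word)
  show "uea.span (to_U ` P_monomials) = U0" unfolding img by (rule U0_spanned)
  show "uea.independent (to_U ` P_monomials)"
    unfolding img uea.dependent_explicit
  proof clarsimp
    fix T r v
    assume T: "finite T" "T \<subseteq> ?val ` ?SP" "(\<Sum>v\<in>T. uea_scale (r v) v) = 0" and v: "v \<in> T"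
    obtain S where S: "S \<subseteq> ?SP" "finite S" "T = ?val ` S" using finite_subset_image[OF T(1,2)] by blast
    have inj: "inj_on ?val S" using semi_perfect_value_inj S(1) by (rule inj_on_subset)
    have "(\<Sum>Y\<in>S. uea_scale (r (?val Y)) (?val Y)) = 0"
      using T(3) unfolding S(3) by (simp add: sum.reindex[OF inj])
    then show "r v = 0"
      using semi_perfect_values_independent[OF S(2), of "\<lambda>Y. r (?val Y)"] S v by auto
  qed
qed

section \<open>The ideal of relations\<close>

text \<open>
  The uniqueness that the definite description requires is the linear independence of the values
  of semi-perfect words.
\<close>

lemma normal_form_eqI:
  assumes "Z \<in> F.span (word_F ` {Y. semi_perfect Y})" and "to_U Z = to_U X"
  shows "normal_form X = Z"
  unfolding normal_form_def
proof (rule the_equality)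
  fix Y assume Y: "Y \<in> F.span (word_F ` {Y. semi_perfect Y}) \<and> to_U Y = to_U X"
  have "Y - Z = 0"
    by (rule to_U_injective_on_normal_forms) (use Y assms in \<open>simp_all add: F.span_diff to_U_diff\<close>)
  then show "Y = Z" by simp
qed (use assms in simp)

lemma to_U_normal_form:
  assumes "to_U X \<in> U0"
  shows "to_U (normal_form X) = to_U X"
proof -
  have "to_U X \<in> uea.span (to_U ` word_F ` {Y. semi_perfect Y})"
    using assms U0_spanned by (simp add: image_image to_U_word)
  then obtain Z where "Z \<in> F.span (word_F ` {Y. semi_perfect Y})" "to_U Z = to_U X"
    using to_U_span_image by blast
  then show ?thesis using normal_form_eqI by simp
qed

lemma prod_cF_eq: "prod_list (map cF w) = word_F (map CL w)"
  by (simp add: word_F_def comp_def)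

lemma reduction_relation_in_K: "reduction_relation w \<in> K_ideal"
  using to_U_normal_form[of "word_F (map CL w)"] omega_value_in_U0[of "map CL w"]
  by (simp add: reduction_relation_def K_ideal_def prod_cF_eq to_U_diff to_U_word)

lemma two_sided_ideal_K: "two_sided_ideal K_ideal"
  by (auto simp: two_sided_ideal_def K_ideal_def to_U_zero to_U_add to_U_mult)

lemma ideal_K_tilde_subset_K: "ideal_generated_by K_tilde \<subseteq> K_ideal"
  by (rule hull_minimal[where S = two_sided_ideal, OF _ two_sided_ideal_K])
    (use reduction_relation_in_K in \<open>auto simp: K_tilde_def K'_def\<close>)

abbreviation (input) quadratic_ideal :: "F set" where "quadratic_ideal \<equiv> ideal_generated_by K_tilde"

lemma quadratic_ideal_closed:
  "0 \<in> quadratic_ideal" "x \<in> quadratic_ideal \<Longrightarrow> y \<in> quadratic_ideal \<Longrightarrow> x + y \<in> quadratic_ideal" "x \<in> quadratic_ideal \<Longrightarrow> a * x \<in> quadratic_ideal" "x \<in> quadratic_ideal \<Longrightarrow> x * a \<in> quadratic_ideal"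
  "x \<in> quadratic_ideal \<Longrightarrow> - x \<in> quadratic_ideal"
  using two_sided_ideal_hull[of K_tilde] two_sided_ideal_uminus
  unfolding two_sided_ideal_def by blast+

lemma two_letter_relation_in_quadratic_ideal: "reduction_relation [c, c'] \<in> quadratic_ideal"
  by (rule hull_inc) (auto simp: K_tilde_def K'_def has_Len_def intro!: exI[of _ "[c, c']"])

definition spanned_modulo_quadratic :: "letter list set \<Rightarrow> F set" where
  "spanned_modulo_quadratic W = {X. \<exists>Z\<in>F.span (word_F ` W). X - Z \<in> quadratic_ideal}"

lemma spanned_modulo_quadratic_zero: "0 \<in> spanned_modulo_quadratic W"
  using F.span_zero quadratic_ideal_closed(1) by (auto simp: spanned_modulo_quadratic_def intro!: bexI[of _ 0])

lemma spanned_modulo_quadratic_add: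
  assumes "X \<in> spanned_modulo_quadratic W" and "X' \<in> spanned_modulo_quadratic W"
  shows "X + X' \<in> spanned_modulo_quadratic W"
proof -
  from assms obtain Z Z' where Z: "Z \<in> F.span (word_F ` W)" "X - Z \<in> quadratic_ideal"
    "Z' \<in> F.span (word_F ` W)" "X' - Z' \<in> quadratic_ideal" by (auto simp: spanned_modulo_quadratic_def)
  then have "(X - Z) + (X' - Z') \<in> quadratic_ideal" "Z + Z' \<in> F.span (word_F ` W)"
    by (auto intro: quadratic_ideal_closed F.span_add)
  then show ?thesis unfolding spanned_modulo_quadratic_def by (auto simp: algebra_simps)
qed

lemma F_scale_in_quadratic_ideal: "X \<in> quadratic_ideal \<Longrightarrow> F_scale a X \<in> quadratic_ideal"
  unfolding F_scale_def by (rule quadratic_ideal_closed)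

lemma spanned_modulo_quadratic_scale:
  assumes "X \<in> spanned_modulo_quadratic W"
  shows "F_scale a X \<in> spanned_modulo_quadratic W"
proof -
  from assms obtain Z where "Z \<in> F.span (word_F ` W)" "X - Z \<in> quadratic_ideal" by (auto simp: spanned_modulo_quadratic_def)
  then have "F_scale a Z \<in> F.span (word_F ` W)" "F_scale a X - F_scale a Z \<in> quadratic_ideal"
    using F_scale_in_quadratic_ideal[of "X - Z" a] by (auto simp: F.span_scale F.scale_right_diff_distrib)
  then show ?thesis by (auto simp: spanned_modulo_quadratic_def)
qed

lemma spanned_modulo_quadratic_of_span: "X \<in> F.span (word_F ` W) \<Longrightarrow> X \<in> spanned_modulo_quadratic W"
  using quadratic_ideal_closed(1) by (auto simp: spanned_modulo_quadratic_def intro!: bexI[of _ X])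

lemma spanned_modulo_quadratic_of_ideal: "X \<in> quadratic_ideal \<Longrightarrow> X \<in> spanned_modulo_quadratic W"
  using F.span_zero by (auto simp: spanned_modulo_quadratic_def intro!: bexI[of _ 0])

lemma spanned_modulo_quadratic_trans:
  assumes "X \<in> spanned_modulo_quadratic V" and "\<And>Y. Y \<in> V \<Longrightarrow> word_F Y \<in> spanned_modulo_quadratic W"
  shows "X \<in> spanned_modulo_quadratic W"
proof -
  from assms(1) obtain Z where Z: "Z \<in> F.span (word_F ` V)" "X - Z \<in> quadratic_ideal" by (auto simp: spanned_modulo_quadratic_def)
  from Z(1) have "Z \<in> spanned_modulo_quadratic W"
  proof (induction Z rule: F.span_induct_alt)
    case (step c x y)
    then show ?case using assms(2) by (auto intro!: spanned_modulo_quadratic_add spanned_modulo_quadratic_scale)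
  qed (rule spanned_modulo_quadratic_zero)
  from spanned_modulo_quadratic_add[OF spanned_modulo_quadratic_of_ideal[OF Z(2)] this] show ?thesis by simp
qed

text \<open>
  The degree of a word in the generators is the number of basis vectors of the Lie algebra that it
  stands for.  The elements of \<open>lower d\<close> are the errors that may be neglected in degree \<open>d\<close>.
\<close>

definition lower :: "nat \<Rightarrow> F set" where
  "lower d = spanned_modulo_quadratic {Y. length (omega Y) < d}"

lemma lower_mult:
  assumes "X \<in> lower d"
  shows "word_F U * X * word_F V \<in> lower (length (omega U) + d + length (omega V))"
proof -
  from assms obtain Z where Z: "Z \<in> F.span (word_F ` {Y. length (omega Y) < d})" "X - Z \<in> quadratic_ideal"
    by (auto simp: lower_def spanned_modulo_quadratic_def)
  let ?W = "{Y. length (omega Y) < length (omega U) + d + length (omega V)}"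
  from Z(1) have "word_F U * Z * word_F V \<in> F.span (word_F ` ?W)"
  proof (induction Z rule: F.span_induct_alt)
    case (step c x y)
    from step(1) obtain Y where Y: "x = word_F Y" "length (omega Y) < d" by auto
    have "word_F (U @ Y @ V) \<in> F.span (word_F ` ?W)"
      by (intro F.span_base imageI) (use Y in simp)
    then have "word_F U * x * word_F V \<in> F.span (word_F ` ?W)" by (simp add: Y(1) mult.assoc)
    then show ?case using step(2)
      by (simp add: distrib_left distrib_right F_scale_mult_left F_scale_mult_right F.span_add F.span_scale)
  qed (simp add: F.span_zero)
  moreover have "word_F U * X * word_F V - word_F U * Z * word_F V \<in> quadratic_ideal"
  proof -
    have "word_F U * (X - Z) * word_F V \<in> quadratic_ideal" using Z(2) by (intro quadratic_ideal_closed)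
    then show ?thesis by (simp add: algebra_simps)
  qed
  ultimately show ?thesis unfolding lower_def spanned_modulo_quadratic_def by auto
qed

text \<open>
  The normal form of a word of two letters has the semi-perfect word with the same root vectors as
  its leading term, since in the enveloping algebra the two words differ by shorter words, and
  these are combinations of values of semi-perfect words of lower degree.
\<close>

lemma two_letter_reduction:
  assumes "semi_perfect Y" and "mset (omega Y) = mset (omega [CL c, CL c'])"
  shows "word_F [CL c, CL c'] - word_F Y \<in> lower (length (omega [CL c, CL c']))"
proof -
  let ?w = "[CL c, CL c']" and ?SP = "word_F ` {Y. semi_perfect Y}"
  let ?L = "word_F ` {Y. semi_perfect Y \<and> length (omega Y) < length (omega ?w)}"
  have "word_value (omega ?w) - word_value (omega Y) \<in> values_below (length (omega ?w)) 0"
    using permuted_words[OF assms(2)[symmetric] omega_letters] by (simp only: omega_weight)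
  then have "to_U (word_F ?w - word_F Y) \<in> uea.span (to_U ` ?L)"
    unfolding to_U_diff to_U_word image_image by (rule semi_perfect_span)
  then obtain Z where Z: "Z \<in> F.span ?L" "to_U Z = to_U (word_F ?w - word_F Y)"
    using to_U_span_image by blast
  have "F.span ?L \<subseteq> F.span ?SP" by (rule F.span_mono) auto
  then have "word_F Y + Z \<in> F.span ?SP" using Z(1) assms(1) by (intro F.span_add) (auto intro: F.span_base)
  then have "normal_form (word_F ?w) = word_F Y + Z"
    by (rule normal_form_eqI) (use Z(2) in \<open>simp add: to_U_add to_U_diff\<close>)
  then have "word_F ?w - word_F Y - Z \<in> quadratic_ideal"
    using two_letter_relation_in_quadratic_ideal[of c c'] by (simp add: reduction_relation_def diff_diff_eq)
  moreover have "F.span ?L \<subseteq> F.span (word_F ` {Y. length (omega Y) < length (omega ?w)})"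
    by (rule F.span_mono) auto
  ultimately show ?thesis using Z(1) unfolding lower_def spanned_modulo_quadratic_def by blast
qed

lemma lower_uminus: "X \<in> lower d \<Longrightarrow> - X \<in> lower d"
  using spanned_modulo_quadratic_scale[of X _ "-1"] by (simp add: lower_def F.scale_minus_left)

text \<open>
  Both orders of two letters reduce to the same semi-perfect word.
\<close>

lemma letters_commute_modulo_lower:
  "word_F [l, l'] - word_F [l', l] \<in> lower (length (omega [l, l']))"
proof (cases l)
  case (HL h)
  then show ?thesis by (simp add: hF_commutes lower_def spanned_modulo_quadratic_zero)
next
  case c: (CL c)
  show ?thesis
  proof (cases l')
    case (HL h)
    then show ?thesis by (simp add: hF_commutes lower_def spanned_modulo_quadratic_zero)
  next
    case c': (CL c')
    obtain Y where Y: "semi_perfect Y" "mset (omega Y) = mset (omega [l, l'])"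
      by (rule semi_perfect_exists[OF omega_letters omega_weight])
    have "word_F [l, l'] - word_F Y \<in> lower (length (omega [l, l']))"
      using two_letter_reduction[OF Y(1), of c c'] Y(2) c c' by simp
    moreover have "word_F [l', l] - word_F Y \<in> lower (length (omega [l, l']))"
      using two_letter_reduction[OF Y(1), of c' c] Y(2) c c' by (simp add: add.commute)
    ultimately show ?thesis
      using spanned_modulo_quadratic_add lower_uminus unfolding lower_def by fastforce
  qed
qed

lemma permuted_word_F:
  assumes "mset Y = mset Y'"
  shows "word_F Y - word_F Y' \<in> lower (length (omega Y))"
proof -
  let ?L = "\<lambda>M. lower (\<Sum>l\<in>#M. length (letter_word l))"
  have len: "(\<Sum>l\<in>#mset Y. length (letter_word l)) = length (omega Y)" for Y
    by (induction Y) simp_all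
  have "prod_list (map letter_F Y) - prod_list (map letter_F Y') \<in> ?L (mset Y)"
  proof (rule permuted_products[where A = UNIV and L = ?L])
    fix x M s assume "s \<in> ?L M"
    from lower_mult[OF this, of "[x]" "[]"] show "letter_F x * s \<in> ?L (add_mset x M)" by simp
  next
    fix x y v
    from lower_mult[OF letters_commute_modulo_lower[of x y], of "[]" v]
    have "word_F (x # y # v) - word_F (y # x # v) \<in> lower (length (omega (x # y # v)))"
      by (simp add: algebra_simps)
    then show "letter_F x * letter_F y * prod_list (map letter_F v)
        - letter_F y * letter_F x * prod_list (map letter_F v) \<in> ?L (mset (x # y # v))"
      unfolding len by (simp add: mult.assoc flip: word_F_def)
  qed (use assms in \<open>auto simp: lower_def intro: spanned_modulo_quadratic_zero spanned_modulo_quadratic_add\<close>)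
  then show ?thesis unfolding len word_F_def .
qed

text \<open>
  The generators from \<^const>\<open>C5\<close> on are the boundary rays of the sectors in
  \<open>toric_factorization\<close>.  The other four are products of two opposite root vectors.
\<close>

definition ray_letter :: "c_letter \<Rightarrow> bool" where
  "ray_letter c \<longleftrightarrow> 5 \<le> c_index c"

lemma not_ray_letter_iff: "\<not> ray_letter c \<longleftrightarrow> c \<in> {C1, C2, C3, C4}"
  by (cases c) (simp_all add: ray_letter_def)

fun ray_length :: "letter \<Rightarrow> nat" where
  "ray_length (HL h) = 0"
| "ray_length (CL c) = (if ray_letter c then length (c_word c) else 0)"

lemma ray_length_le: "ray_length l \<le> length (letter_word l)"
  by (cases l) simp_all

lemma ray_length_omega_le: "sum_list (map ray_length Y) \<le> length (omega Y)"
  by (induction Y) (simp_all add: add_mono ray_length_le)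

lemma ray_length_less:
  assumes "CL z \<in> set Y" and "\<not> ray_letter z"
  shows "sum_list (map ray_length Y) < length (omega Y)"
  using assms(1)
proof (induction Y)
  case (Cons l Y)
  show ?case
  proof (cases "l = CL z")
    case True
    have "0 < length (letter_word l)" by simp
    then show ?thesis using True assms(2) ray_length_omega_le[of Y] by (simp add: add_strict_increasing del: letter_word.simps)
  next
    case False
    then show ?thesis using Cons ray_length_le[of l] by (simp add: add_le_less_mono)
  qed
qed simp

lemma non_edge_opposite_letters:
  assumes "ray_letter c" "ray_letter c'" "c \<noteq> c'" "(c, c') \<notin> E_pairs" "(c', c) \<notin> E_pairs"
  shows "\<exists>z\<in>{C1, C2, C3, C4}. set (c_word z) \<subseteq> set (c_word c) \<union> set (c_word c')"
  using assms by (cases c; cases c'; simp add: ray_letter_def E_pairs_def)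

text \<open>
  All edges join one of \<^const>\<open>C5\<close>, \<^const>\<open>C6\<close>, \<^const>\<open>C7\<close>, \<^const>\<open>C8\<close> to one of the
  remaining ray letters.  A graph with such a bipartition contains no triangle.
\<close>

lemma clique_in_edge:
  assumes "\<And>c. c \<in> D \<Longrightarrow> ray_letter c"
    and "\<And>c c'. c \<in> D \<Longrightarrow> c' \<in> D \<Longrightarrow> c \<noteq> c' \<Longrightarrow> (c, c') \<in> E_pairs \<or> (c', c) \<in> E_pairs"
  shows "\<exists>(m, n)\<in>E_pairs. D \<subseteq> {m, n}"
proof -
  have bipartite: "c \<in> {C5, C6, C7, C8}" "c' \<in> {C9, C10, C11, C12}" if "(c, c') \<in> E_pairs" for c c'
    using that by (auto simp: E_pairs_def)
  consider "D = {}" | c where "D = {c}" | c c' where "c \<in> D" "c' \<in> D" "c \<noteq> c'" by blast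
  then show ?thesis
  proof cases
    case 1
    then show ?thesis by (auto simp: E_pairs_def)
  next
    case 2
    have "ray_letter c" using assms(1) 2 by simp
    then show ?thesis using 2 by (cases c) (auto simp: ray_letter_def E_pairs_def)
  next
    case 3
    then obtain m n where mn: "(m, n) \<in> E_pairs" "m \<in> D" "n \<in> D" using assms(2) by blast
    have "c \<in> {m, n}" if "c \<in> D" for c
    proof (rule ccontr)
      assume "c \<notin> {m, n}"
      then have "(c, m) \<in> E_pairs \<or> (m, c) \<in> E_pairs" "(c, n) \<in> E_pairs \<or> (n, c) \<in> E_pairs"
        using assms(2)[OF that] mn by auto
      then show False using bipartite mn(1) by force
    qed
    then show ?thesis using mn(1) by blast
  qed
qed

text \<open>
  Up to lower degree, letters may be permuted.  If two ray letters of the word do not form an edge,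
  they contain opposite root vectors, so that the semi-perfect word replacing them involves one of
  the first four generators.  This keeps the degree but reduces the part of it that is due to ray
  letters.  If all pairs of ray letters are edges, at most two different ones occur, and sorting
  makes the word semi-perfect.
\<close>

lemma word_F_reduces: "word_F Y \<in> spanned_modulo_quadratic {Y. semi_perfect Y}"
proof (induction Y rule: wf_induct_rule[OF wf_measures[of "[\<lambda>Y. length (omega Y), \<lambda>Y. sum_list (map ray_length Y)]"]])
  case (1 Y)
  let ?good = "spanned_modulo_quadratic {Y. semi_perfect Y}" and ?\<rho> = "\<lambda>Y. sum_list (map ray_length Y)"
  let ?d = "length (omega Y)"
  have lower: "X \<in> ?good" if "X \<in> lower ?d" for X
    using that unfolding lower_def by (rule spanned_modulo_quadratic_trans) (use 1 in auto)
  show ?case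
  proof (cases "\<exists>c c'. CL c \<in> set Y \<and> CL c' \<in> set Y \<and> ray_letter c \<and> ray_letter c' \<and> c \<noteq> c'
      \<and> (c, c') \<notin> E_pairs \<and> (c', c) \<notin> E_pairs")
    case True
    then obtain c c' where c: "CL c \<in> set Y" "CL c' \<in> set Y" and ray: "ray_letter c" "ray_letter c'"
      and ne: "c \<noteq> c'" "(c, c') \<notin> E_pairs" "(c', c) \<notin> E_pairs" by blast
    obtain R where Y: "mset Y = mset ([CL c, CL c'] @ R)"
    proof -
      obtain p q where Y: "Y = p @ CL c # q" using split_list[OF c(1)] by blast
      then have "CL c' \<in> set (p @ q)" using c(2) ne(1) by auto
      then obtain p' q' where pq: "p @ q = p' @ CL c' # q'" using split_list by metis
      have "mset Y = mset ([CL c, CL c'] @ (p' @ q'))"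
        using arg_cong[OF pq, of mset] by (simp add: Y)
      then show thesis by (rule that)
    qed
    obtain Z where Z: "semi_perfect Z" "mset (omega Z) = mset (omega [CL c, CL c'])"
      by (rule semi_perfect_exists[OF omega_letters omega_weight])
    obtain z where z: "z \<in> {C1, C2, C3, C4}" "set (c_word z) \<subseteq> set (c_word c) \<union> set (c_word c')"
      using non_edge_opposite_letters[OF ray ne] by blast
    have "set (omega Z) = set (c_word c) \<union> set (c_word c')"
      using mset_eq_setD[OF Z(2)] by simp
    then have "CL z \<in> set Z"
      using admissible_opposite_letters[OF semi_perfect_admissible[OF Z(1)] z(1)] z(2) by simp
    then have less: "?\<rho> Z < length (omega Z)"
      using ray_length_less z(1) not_ray_letter_iff by blast
    have lenZ: "length (omega Z) = length (c_word c) + length (c_word c')"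
      using mset_eq_length[OF Z(2)] by simp
    have lenY: "?d = length (omega Z) + length (omega R)" and \<rho>Y: "?\<rho> Y = length (omega Z) + ?\<rho> R"
    proof -
      have sums: "length (omega U) = (\<Sum>l\<in>#mset U. length (letter_word l))"
        "?\<rho> U = (\<Sum>l\<in>#mset U. ray_length l)" for U
        by (induction U) simp_all
      show "?d = length (omega Z) + length (omega R)"
        unfolding lenZ sums(1)[of Y] Y by (simp add: sums(1)[of R])
      show "?\<rho> Y = length (omega Z) + ?\<rho> R"
        unfolding lenZ sums(2)[of Y] Y using ray by (simp add: sums(2)[of R])
    qed
    have "word_F Y - word_F ([CL c, CL c'] @ R) \<in> ?good"
      by (rule lower) (rule permuted_word_F[OF Y])
    moreover have "word_F ([CL c, CL c'] @ R) - word_F (Z @ R) \<in> ?good"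
    proof (rule lower)
      show "word_F ([CL c, CL c'] @ R) - word_F (Z @ R) \<in> lower ?d"
        using lower_mult[OF two_letter_reduction[OF Z], of "[]" R] lenY lenZ by (simp add: algebra_simps)
    qed
    moreover have "word_F (Z @ R) \<in> ?good"
      by (rule 1) (use less lenY \<rho>Y in simp)
    ultimately have "(word_F Y - word_F ([CL c, CL c'] @ R)) + (word_F ([CL c, CL c'] @ R) - word_F (Z @ R))
        + word_F (Z @ R) \<in> ?good"
      by (intro spanned_modulo_quadratic_add)
    then show ?thesis by (simp only: diff_add_cancel add_diff_eq)
  next
    case False
    let ?Z = "sort_key letter_index Y"
    have "\<exists>(m, n)\<in>E_pairs. {c. CL c \<in> set Y \<and> ray_letter c} \<subseteq> {m, n}"
      by (rule clique_in_edge) (use False in blast)+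
    then obtain m n where mn: "(m, n) \<in> E_pairs" "{c. CL c \<in> set Y \<and> ray_letter c} \<subseteq> {m, n}" by blast
    have "c \<in> {C1, C2, C3, C4, m, n}" if "CL c \<in> set ?Z" for c
      using that mn(2) not_ray_letter_iff[of c] by (cases "ray_letter c") auto
    then have "admissible ?Z"
      unfolding admissible_def using mn(1) by (intro conjI bexI[of _ "(m, n)"]) simp_all
    then have "semi_perfect ?Z" by (rule admissible_semi_perfect)
    then have "word_F ?Z \<in> ?good" by (intro spanned_modulo_quadratic_of_span F.span_base) auto
    moreover have "word_F Y - word_F ?Z \<in> ?good"
      by (rule lower) (rule permuted_word_F, simp)
    ultimately have "(word_F Y - word_F ?Z) + word_F ?Z \<in> ?good" by (intro spanned_modulo_quadratic_add)
    then show ?thesis by simp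
  qed
qed

text \<open>
  A relation reduces to a combination of semi-perfect words whose value is zero.  By linear
  independence of these values the combination is trivial.
\<close>

theorem quadratic_ideal_eq_K: "quadratic_ideal = K_ideal"
proof
  show "quadratic_ideal \<subseteq> K_ideal" by (rule ideal_K_tilde_subset_K)
  show "K_ideal \<subseteq> quadratic_ideal"
  proof
    fix X assume X: "X \<in> K_ideal"
    have "X \<in> spanned_modulo_quadratic {Y. semi_perfect Y}"
      by (rule spanned_modulo_quadratic_trans[OF spanned_modulo_quadratic_of_span[OF F_span_words]])
        (rule word_F_reduces)
    then obtain Z where Z: "Z \<in> F.span (word_F ` {Y. semi_perfect Y})" "X - Z \<in> quadratic_ideal"
      by (auto simp: spanned_modulo_quadratic_def)
    have "to_U (X - Z) = 0" using Z(2) ideal_K_tilde_subset_K by (auto simp: K_ideal_def)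
    then have "to_U Z = 0" using X by (simp add: to_U_diff K_ideal_def)
    then have "Z = 0" using to_U_injective_on_normal_forms Z(1) by blast
    then show "X \<in> quadratic_ideal" using Z(2) by simp
  qed
qed

theorem proposition5p1:
  shows "(inj_on to_U P_monomials \<and> uea.independent (to_U ` P_monomials)
            \<and> uea.span (to_U ` P_monomials) = U0)
    \<and> ideal_generated_by K_tilde = K_ideal"
  using P_values_basis quadratic_ideal_eq_K by blast

end
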